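(* Let $q$ be an odd prime power, $t>4$, $n=2t$. For $h\in\mathbb{F}_{q^n}$ with $h^{q^t+1}=-1$ let $\psi_{h,t}(x)= x^{q}+x^{q^{t-1}}-h^{1-q^{t+1}}x^{q^{t+1}}+h^{1-q^{2t-1}}x^{q^{2t-1}}$ and $\mathcal{C}_{h,t}=\{ax+b\psi_{h,t}(x):a,b\in\mathbb{F}_{q^n}\}$. For $h,k\in\mathbb{F}_{q^n}$ with $h^{q^t+1}=k^{q^t+1}=-1$: (a) if $t\not\equiv 2\pmod 4$, then $\mathcal{C}_{h,t}$ and $\mathcal{C}_{k,t}$ are equivalent if and only if $h=\pm k^\rho$ for some $\rho\in\operatorname{Aut}(\mathbb{F}_{q^n})$; (b) if $t\equiv 2\pmod 4$, then $\mathcal{C}_{h,t}$ and $\mathcal{C}_{k,t}$ are equivalent if and only if $h=\ell k^\rho$ for some $\ell$ with $\ell^{q^2+1}=1$ and some $\rho\in\operatorname{Aut}(\mathbb{F}_{q^n})$. Moreover, the full automorphism group $\operatorname{Aut}(\mathcal{C}_{h,t})$ is isomorphic to $(\mathbb{F}_{q^n}^*,\cdot)\times(\mathbb{F}_{q^2}^*,\cdot)\rtimes H$, where $H=\{\rho\in\operatorname{Aut}(\mathbb{F}_{q^n}):h=\pm h^\rho\}$ if $t\not\equiv 2\pmod 4$ and $H=\{\rho\in\operatorname{Aut}(\mathbb{F}_{q^n}):(h^\rho/h)^{q^2+1}=1\}$ if $t\equiv 2\pmod 4$.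
   Context: $q$-polynomials over $\mathbb{F}_{q^n}$ ($\sum_{i=0}^{n-1}c_ix^{q^i}$, considered modulo $x^{q^n}-x$) are identified with $\mathbb{F}_q$-linear maps of $\mathbb{F}_{q^n}$. For $\varphi=\sum a_ix^{q^i}$ and $\rho\in\operatorname{Aut}(\mathbb{F}_{q^n})$, $\varphi^\rho=\sum a_i^\rho x^{q^i}$. Two sets $\mathcal{C},\mathcal{C}'$ of $q$-polynomials (rank-distance codes) are equivalent if there exist invertible $q$-polynomials $L_1,L_2$ and $\rho\in\operatorname{Aut}(\mathbb{F}_{q^n})$ with $\mathcal{C}'=\{L_1\circ\varphi^\rho\circ L_2:\varphi\in\mathcal{C}\}$. $\operatorname{Aut}(\mathcal{C})$ is the group of all triples $(L_1,L_2,\rho)$ with $\{L_1\circ\varphi^\rho\circ L_2:\varphi\in\mathcal{C}\}=\mathcal{C}$.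
   Formalization: Aut(C) is taken modulo the n triples (L1,L2,ρ) with L1∘ρ = id and ρ^{-1}∘L2 = id, which fix every q-polynomial; the group of all triples, read literally, is n times larger than the claimed group. *)

theory Defs
  imports
    "HOL-Computational_Algebra.Polynomial"
    "HOL-Number_Theory.Prime_Powers"
    "HOL-Algebra.Coset"
    "HOL-Algebra.Bij"
begin

text \<open>
  Throughout, the field of order \<open>q\<^sup>n\<close> is a finite type \<open>'a\<close> of class \<open>field\<close> with
  \<open>card (UNIV :: 'a set) = q ^ n\<close>. A \<open>q\<close>-polynomial is represented by its reduced representative of
  degree below \<open>q ^ n\<close>, and \<open>q_comp\<close> reduces modulo \<open>x ^ (q ^ n) - x\<close>.
\<close>

definition q_polys :: "nat \<Rightarrow> nat \<Rightarrow> 'a::field poly set" where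
  "q_polys q n = {\<Sum>i<n. monom (c i) (q ^ i) | c :: nat \<Rightarrow> 'a. True}"

definition q_comp :: "nat \<Rightarrow> nat \<Rightarrow> 'a::field poly \<Rightarrow> 'a poly \<Rightarrow> 'a poly" where
  "q_comp q n f g = pcompose f g mod (monom 1 (q ^ n) - monom 1 1)"

definition inv_q_polys :: "nat \<Rightarrow> nat \<Rightarrow> 'a::field poly set" where
  "inv_q_polys q n =
     {L \<in> q_polys q n. \<exists>M \<in> q_polys q n. q_comp q n L M = monom 1 1 \<and> q_comp q n M L = monom 1 1}"

definition field_auts :: "('a::field \<Rightarrow> 'a) set" where
  "field_auts = {\<rho>. bij \<rho> \<and> \<rho> 1 = 1 \<and> (\<forall>x y. \<rho> (x + y) = \<rho> x + \<rho> y) \<and> (\<forall>x y. \<rho> (x * y) = \<rho> x * \<rho> y)}"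

text \<open>With \<open>map_poly \<rho> \<phi>\<close> for \<open>\<phi>\<^sup>\<rho>\<close>, the set of all \<open>L1 \<circ> \<phi>\<^sup>\<rho> \<circ> L2\<close>:\<close>

definition code_image ::
  "nat \<Rightarrow> nat \<Rightarrow> 'a::field poly \<Rightarrow> 'a poly \<Rightarrow> ('a \<Rightarrow> 'a) \<Rightarrow> 'a poly set \<Rightarrow> 'a poly set" where
  "code_image q n L1 L2 \<rho> C = (\<lambda>\<phi>. q_comp q n (q_comp q n L1 (map_poly \<rho> \<phi>)) L2) ` C"

definition equiv_codes :: "nat \<Rightarrow> nat \<Rightarrow> 'a::field poly set \<Rightarrow> 'a poly set \<Rightarrow> bool" where
  "equiv_codes q n C C' \<longleftrightarrow>
     (\<exists>L1 \<in> inv_q_polys q n. \<exists>L2 \<in> inv_q_polys q n. \<exists>\<rho> \<in> field_auts. C' = code_image q n L1 L2 \<rho> C)"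

text \<open>
  The multiplication below is the one for which \<open>(L1, L2, \<rho>)\<close> acts on \<open>q\<close>-polynomials by
  \<open>\<phi> \<mapsto> L1 \<circ> \<phi>\<^sup>\<rho> \<circ> L2\<close>: the action of a product is the composition of the actions.
\<close>

definition aut_triples ::
  "nat \<Rightarrow> nat \<Rightarrow> 'a::field poly set \<Rightarrow> ('a poly \<times> 'a poly \<times> ('a \<Rightarrow> 'a)) monoid" where
  "aut_triples q n C =
     \<lparr>carrier = {(L1, L2, \<rho>). L1 \<in> inv_q_polys q n \<and> L2 \<in> inv_q_polys q n \<and> \<rho> \<in> field_auts \<and>
                  code_image q n L1 L2 \<rho> C = C},
      mult = (\<lambda>(L1, L2, \<rho>) (M1, M2, \<sigma>).
                (q_comp q n L1 (map_poly \<rho> M1), q_comp q n (map_poly \<rho> M2) L2, \<rho> \<circ> \<sigma>)),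
      one = (monom 1 1, monom 1 1, id)\<rparr>"

text \<open>
  As maps, \<open>\<phi>\<^sup>\<rho> = \<rho> \<circ> \<phi> \<circ> \<rho>\<^sup>-\<^sup>1\<close>, so \<open>(L1, L2, \<rho>)\<close> acts through the pair of semilinear maps
  \<open>(L1 \<circ> \<rho>, \<rho>\<^sup>-\<^sup>1 \<circ> L2)\<close>. A triple is not determined by this pair: \<open>(x\<^sup>q, x ^ (q ^ (n - 1)), \<rho>)\<close>
  with \<open>\<rho>\<close> the inverse of \<open>x \<mapsto> x\<^sup>q\<close> is an invertible triple different from the identity, but its
  pair is \<open>(id, id)\<close>, and it fixes every \<open>q\<close>-polynomial. The triples with pair \<open>(id, id)\<close> are the
  \<open>n\<close> powers of this one. Triples are therefore identified when they induce the same
  pair; without this, every automorphism group would be larger by the factor \<open>n\<close>.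
  (The scalar triples \<open>(a x, a\<^sup>-\<^sup>1 x, id)\<close> remain distinct elements of the group.)
\<close>

definition trivial_triples :: "nat \<Rightarrow> nat \<Rightarrow> ('a::field poly \<times> 'a poly \<times> ('a \<Rightarrow> 'a)) set" where
  "trivial_triples q n =
     {(L1, L2, \<rho>). L1 \<in> inv_q_polys q n \<and> L2 \<in> inv_q_polys q n \<and> \<rho> \<in> field_auts \<and>
        poly L1 \<circ> \<rho> = id \<and> inv_into UNIV \<rho> \<circ> poly L2 = id}"

definition aut_group ::
  "nat \<Rightarrow> nat \<Rightarrow> 'a::field poly set \<Rightarrow> ('a poly \<times> 'a poly \<times> ('a \<Rightarrow> 'a)) set monoid" where
  "aut_group q n C = aut_triples q n C Mod trivial_triples q n"

definition psi :: "nat \<Rightarrow> nat \<Rightarrow> 'a::field \<Rightarrow> 'a poly" where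
  "psi q t h =
     monom 1 q + monom 1 (q ^ (t - 1))
     - monom (h powi (1 - int q ^ (t + 1))) (q ^ (t + 1))
     + monom (h powi (1 - int q ^ (2 * t - 1))) (q ^ (2 * t - 1))"

definition code :: "nat \<Rightarrow> nat \<Rightarrow> 'a::field \<Rightarrow> 'a poly set" where
  "code q t h = {smult a (monom 1 1) + smult b (psi q t h) | a b. True}"

text \<open>For \<open>m\<close> dividing \<open>n\<close>, the subfield of order \<open>q ^ m\<close> is the set of roots of \<open>x ^ (q ^ m) - x\<close>.\<close>

definition subfield_units :: "nat \<Rightarrow> nat \<Rightarrow> 'a::field monoid" where
  "subfield_units q m = \<lparr>carrier = {x. x ^ (q ^ m) = x \<and> x \<noteq> 0}, mult = (*), one = 1\<rparr>"

definition aut_stabilizer :: "nat \<Rightarrow> nat \<Rightarrow> 'a::field \<Rightarrow> ('a \<Rightarrow> 'a) monoid" where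
  "aut_stabilizer q t h =
     \<lparr>carrier = {\<rho> \<in> field_auts.
        if t mod 4 = 2 then (\<rho> h / h) ^ (q\<^sup>2 + 1) = 1 else h = \<rho> h \<or> h = - \<rho> h},
      mult = (\<circ>), one = id\<rparr>"

definition semidirect ::
  "('a, 'm) monoid_scheme \<Rightarrow> ('b, 'k) monoid_scheme \<Rightarrow> ('b \<Rightarrow> 'a \<Rightarrow> 'a) \<Rightarrow> ('a \<times> 'b) monoid" where
  "semidirect N H \<theta> =
     \<lparr>carrier = carrier N \<times> carrier H,
      mult = (\<lambda>(x, g) (y, k). (x \<otimes>\<^bsub>N\<^esub> \<theta> g y, g \<otimes>\<^bsub>H\<^esub> k)),
      one = (\<one>\<^bsub>N\<^esub>, \<one>\<^bsub>H\<^esub>)\<rparr>"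

end

theory Submission
  imports Defs
begin

text \<open>Write \<open>Q\<close> for \<open>x \<mapsto> x ^ q\<close>, \<open>P\<close> for its inverse and \<open>J\<close> for \<open>x \<mapsto> x ^ (q ^ t)\<close>, so that
  \<open>J h = - 1 / h\<close>. The polynomial \<open>psi q t h\<close> induces the map
  \<open>psi_map h x = Q x + P (J x) + h * Q h * Q (J x) + h / P h * P x\<close>, and a code becomes the set
  \<open>code_maps h\<close> of all maps \<open>a * x + b * psi_map h x\<close>.

  The left idealizer of \<open>code_maps h\<close> consists of the scalars. Hence the semilinear map on the left
  of any equivalence is a scalar multiple of a field automorphism \<open>\<tau>\<close>, which carries \<open>code_maps h\<close>
  to \<open>code_maps (\<tau> h)\<close>, and only equations \<open>code_maps g \<circ> w = code_maps k\<close> remain. As \<open>t > 4\<close>, the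
  maps \<open>x\<close>, \<open>Q x\<close>, \<open>P x\<close>, \<open>Q (Q x)\<close>, \<open>P (P x)\<close> and their composites with \<open>J\<close> are linearly independent;
  comparing coefficients in \<open>psi_map g \<circ> w\<close> gives \<open>l * Q (Q l) = 1\<close> for \<open>l = g / k\<close>. Together with
  \<open>l * J l = 1\<close> this means \<open>l = 1\<close> or \<open>l = - 1\<close> unless \<open>t mod 4 = 2\<close>. The same comparison for
  \<open>g = k = h\<close> yields the right idealizer, a field of order \<open>q\<^sup>2\<close>. The extension of
  \<open>aut_stabilizer q t h\<close>
    by its unit group splits: if \<open>t mod 4 = 2\<close>, then \<open>h = f ^ (q + 1)\<close> for
  some \<open>f\<close>, and \<open>\<rho> \<mapsto> \<rho> f / f\<close> is the required cocycle; otherwise \<open>f = 1\<close> will do.\<close>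

section \<open>Counting arguments in finite fields\<close>

text \<open>Multiplication by a nonzero \<open>x\<close> permutes the nonzero elements, so their
  product, which is not zero, equals \<open>x ^ card ?U\<close> times itself.\<close>

lemma power_card_UNIV_eq:
  fixes x :: "'a::{field,finite}"
  shows "x ^ card (UNIV :: 'a set) = x"
proof (cases "x = 0")
  case True
  then show ?thesis by (simp add: power_0_left)
next
  case False
  let ?U = "UNIV - {0 :: 'a}"
  have "bij_betw ((*) x) ?U ?U"
    by (rule bij_betwI[where g = "\<lambda>y. y / x"]) (use False in auto)
  then have "prod id ?U = (\<Prod>y\<in>?U. x * y)"
    using prod.reindex_bij_betw[of "(*) x" ?U ?U id] by simp
  also have "\<dots> = x ^ card ?U * prod id ?U"
    by (simp add: prod.distrib)
  finally have "x ^ card ?U = 1" by simp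
  moreover have "card (UNIV :: 'a set) = Suc (card ?U)"
    by (metis UNIV_I card.remove finite)
  ultimately show ?thesis by (metis mult.right_neutral power_Suc)
qed

text \<open>Translation by \<open>1\<close> permutes the field; comparing the sums over it leaves
  \<open>card UNIV\<close> copies of \<open>1\<close> adding up to \<open>0\<close>.\<close>

lemma CHAR_dvd_card_UNIV: "CHAR('a::{field,finite}) dvd card (UNIV :: 'a set)"
proof -
  have "(\<Sum>x\<in>UNIV. x + 1) = (\<Sum>x\<in>UNIV. x :: 'a)"
    by (rule sum.reindex_bij_witness[of _ "\<lambda>x. x - 1" "\<lambda>x. x + 1"]) auto
  then have "of_nat (card (UNIV :: 'a set)) = (0 :: 'a)"
    by (simp add: sum.distrib)
  then show ?thesis by (simp only: of_nat_eq_0_iff_char_dvd)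
qed

text \<open>The map \<open>x \<mapsto> x ^ m\<close> has fibres of size at most \<open>m\<close> and takes its values among the at most
  \<open>r\<close> roots of \<open>y ^ r - 1\<close>, so
    by counting all these roots are \<open>m\<close>-th powers.\<close>

lemma exists_root_of_unit_power:
  fixes y :: "'a::{field,finite}"
  assumes card: "card (UNIV :: 'a set) - 1 = m * r" and "m > 0" "r > 0" and y: "y ^ r = 1"
  shows "\<exists>x. x ^ m = y"
proof -
  let ?U = "UNIV - {0 :: 'a}"
  let ?R = "{z :: 'a. z ^ r = 1}"
  have roots: "card {x :: 'a. x ^ j = c} \<le> j" if "j > 0" for j c
  proof -
    have "degree (monom 1 j + [:- c:]) = j"
      using that by (subst degree_add_eq_left) (auto simp: degree_monom_eq)
    moreover have "{x. poly (monom 1 j + [:- c:]) x = 0} = {x :: 'a. x ^ j = c}"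
      by (auto simp: poly_monom)
    moreover have "monom 1 j + [:- c:] \<noteq> 0"
      using calculation that by auto
    ultimately show ?thesis by (metis card_poly_roots_bound)
  qed
  have cardU: "card ?U = m * r" using card by simp
  have im: "(\<lambda>x. x ^ m) ` ?U \<subseteq> ?R"
  proof
    fix z assume "z \<in> (\<lambda>x. x ^ m) ` ?U"
    then obtain x where x: "x \<noteq> 0" "z = x ^ m" by auto
    have "x * x ^ (m * r) = x ^ Suc (card ?U)" by (simp add: cardU)
    also have "Suc (card ?U) = card (UNIV :: 'a set)"
      by (metis UNIV_I card.remove finite)
    finally have "x ^ (m * r) = 1" using x power_card_UNIV_eq[of x] by simp
    then show "z \<in> ?R" using x by (simp add: power_mult)
  qed
  have "card ?U \<le> (\<Sum>z\<in>(\<lambda>x. x ^ m) ` ?U. card {x. x ^ m = z})"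
  proof -
    have "?U \<subseteq> (\<Union>z\<in>(\<lambda>x. x ^ m) ` ?U. {x. x ^ m = z})" by auto
    then have "card ?U \<le> card (\<Union>z\<in>(\<lambda>x. x ^ m) ` ?U. {x. x ^ m = z})"
      by (intro card_mono) auto
    also have "\<dots> \<le> (\<Sum>z\<in>(\<lambda>x. x ^ m) ` ?U. card {x. x ^ m = z})"
      by (intro card_UN_le) auto
    finally show ?thesis .
  qed
  also have "\<dots> \<le> card ((\<lambda>x. x ^ m) ` ?U) * m"
    using sum_bounded_above[of "(\<lambda>x. x ^ m) ` ?U" "\<lambda>z. card {x. x ^ m = z}" m] roots \<open>m > 0\<close>
    by simp
  finally have "r \<le> card ((\<lambda>x. x ^ m) ` ?U)"
    using \<open>m > 0\<close> by (simp add: cardU)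
  moreover have "card ?R \<le> r" using roots[of r 1] \<open>r > 0\<close> by simp
  ultimately have "(\<lambda>x. x ^ m) ` ?U = ?R"
    using im by (intro card_seteq) auto
  moreover have "y \<in> ?R" using y by simp
  ultimately have "y \<in> (\<lambda>x. x ^ m) ` ?U" by simp
  then show ?thesis by blast
qed

section \<open>Field automorphisms\<close>

lemma field_auts_simps:
  assumes "\<rho> \<in> field_auts"
  shows "\<rho> (x + y) = \<rho> x + \<rho> y" "\<rho> (x * y) = \<rho> x * \<rho> y" "\<rho> 0 = 0" "\<rho> 1 = 1"
    "\<rho> (- x) = - \<rho> x" "\<rho> (x - y) = \<rho> x - \<rho> y" "\<rho> (x / y) = \<rho> x / \<rho> y" "\<rho> (x ^ m) = \<rho> x ^ m"
    "\<rho> x = 0 \<longleftrightarrow> x = 0" "inj \<rho>" "surj \<rho>" "bij \<rho>"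
proof -
  have add: "\<rho> (x + y) = \<rho> x + \<rho> y" and mult: "\<rho> (x * y) = \<rho> x * \<rho> y" and one: "\<rho> 1 = 1"
    and "bij \<rho>" for x y
    using assms by (auto simp: field_auts_def)
  show "\<rho> (x + y) = \<rho> x + \<rho> y" "\<rho> (x * y) = \<rho> x * \<rho> y" "\<rho> 1 = 1" "bij \<rho>"
    by fact+
  show zero: "\<rho> 0 = 0" using add[of 0 0] by (metis add.right_neutral add_left_cancel)
  show inj: "inj \<rho>" and "surj \<rho>" using \<open>bij \<rho>\<close> by (auto simp: bij_def)
  show iff: "\<rho> x = 0 \<longleftrightarrow> x = 0" for x using zero inj by (metis injD)
  show minus: "\<rho> (- x) = - \<rho> x" for x
    using add[of x "- x"] zero by (simp add: eq_neg_iff_add_eq_0 add.commute)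
  show "\<rho> (x - y) = \<rho> x - \<rho> y" using add[of x "- y"] minus by simp
  show "\<rho> (x ^ m) = \<rho> x ^ m" by (induction m) (auto simp: one mult)
  show "\<rho> (x / y) = \<rho> x / \<rho> y"
  proof (cases "y = 0")
    case False
    then show ?thesis using mult[of "x / y" y] iff by (simp add: field_simps)
  qed (simp add: zero)
qed

lemma field_autsI:
  assumes "bij \<rho>" "\<rho> 1 = 1" "\<And>x y. \<rho> (x + y) = \<rho> x + \<rho> y" "\<And>x y. \<rho> (x * y) = \<rho> x * \<rho> y"
  shows "\<rho> \<in> field_auts"
  using assms by (auto simp: field_auts_def)

lemma id_in_field_auts [simp]: "id \<in> field_auts" "(\<lambda>x. x) \<in> field_auts"
  by (auto simp: field_auts_def bij_def)

lemma comp_in_field_auts: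
  "\<rho> \<in> field_auts \<Longrightarrow> \<sigma> \<in> field_auts \<Longrightarrow> \<rho> \<circ> \<sigma> \<in> field_auts"
  by (auto simp: field_auts_def intro: bij_comp)

lemma inv_in_field_auts:
  assumes "\<rho> \<in> field_auts" shows "inv_into UNIV \<rho> \<in> field_auts"
proof (rule field_autsI)
  note r = field_auts_simps[OF assms]
  show "bij (inv_into UNIV \<rho>)" by (simp add: bij_imp_bij_inv r)
  show "inv_into UNIV \<rho> 1 = 1" by (metis inv_f_f r(4) r(10))
  have inv: "\<rho> (inv_into UNIV \<rho> x) = x" for x by (simp add: surj_f_inv_f r)
  have eqI: "inv_into UNIV \<rho> x = y" if "x = \<rho> y" for x y using that by (simp add: r)
  show "inv_into UNIV \<rho> (x + y) = inv_into UNIV \<rho> x + inv_into UNIV \<rho> y" for x y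
    by (rule eqI) (simp add: r inv)
  show "inv_into UNIV \<rho> (x * y) = inv_into UNIV \<rho> x * inv_into UNIV \<rho> y" for x y
    by (rule eqI) (simp add: r inv)
qed

lemma poly_map_poly_field_aut:
  assumes "\<rho> \<in> field_auts"
  shows "poly (map_poly \<rho> p) (\<rho> x) = \<rho> (poly p x)"
proof -
  note r = field_auts_simps[OF assms]
  show ?thesis
    by (induction p) (auto simp: map_poly_pCons r)
qed

section \<open>The Frobenius maps\<close>

locale even_degree_field =
  fixes q t :: nat and T :: "'a::{field,finite} itself"
  assumes q: "primepow q" "odd q" and t: "t > 4"
    and card: "card (UNIV :: 'a set) = q ^ (2 * t)"
begin

lemma q_gt_1: "q > 1"
  using q by (simp add: primepow_gt_Suc_0)

lemma q_eq_CHAR_power: "\<exists>e. q = CHAR('a) ^ e" and prime_CHAR: "prime CHAR('a)"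
proof -
  show pr: "prime CHAR('a)"
    by (intro prime_CHAR_semidom finite_imp_CHAR_pos) auto
  obtain p e where pe: "prime p" "q = p ^ e" using q by (auto simp: primepow_def)
  have "CHAR('a) dvd p ^ (e * (2 * t))"
    using CHAR_dvd_card_UNIV[where 'a = 'a] by (simp add: card pe power_mult)
  then have "CHAR('a) = p"
    using pr pe(1) prime_dvd_power primes_dvd_imp_eq by blast
  then show "\<exists>e. q = CHAR('a) ^ e" using pe by blast
qed

lemma two_neq_0: "(2 :: 'a) \<noteq> 0"
proof
  assume "(2 :: 'a) = 0"
  then have "of_nat 2 = (0 :: 'a)" by simp
  then have "CHAR('a) dvd 2" by (simp only: of_nat_eq_0_iff_char_dvd)
  then have "CHAR('a) = 2" using prime_CHAR primes_dvd_imp_eq two_is_prime_nat by blast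
  moreover obtain e where e: "q = CHAR('a) ^ e" using q_eq_CHAR_power by blast
  moreover have "e > 0" using q_gt_1 e by (cases e) auto
  ultimately show False using q(2) by simp
qed

lemma eq_minus_self_iff: "(x :: 'a) = - x \<longleftrightarrow> x = 0" "- x = x \<longleftrightarrow> x = 0"
  using two_neq_0 by (metis add_eq_0_iff mult_2 mult_eq_0_iff)+

definition fr :: "nat \<Rightarrow> 'a \<Rightarrow> 'a" where "fr i x = x ^ (q ^ i)"

lemma fr_fr: "fr i (fr j x) = fr (i + j) x"
  by (simp add: fr_def power_add mult.commute flip: power_mult)

lemma fr_0 [simp]: "fr 0 x = x"
  by (simp add: fr_def)

lemma fr_full [simp]: "fr (2 * t) x = x"
  using power_card_UNIV_eq[of x] by (simp add: fr_def card)

lemma fr_mod: "fr (i mod (2 * t)) x = fr i x"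
proof -
  have "fr (i + 2 * t * m) x = fr i x" for i m
  proof (induction m arbitrary: i)
    case (Suc m)
    show ?case using Suc[of i] by (metis fr_fr fr_full mult_Suc_right)
  qed auto
  from this[of "i mod (2 * t)" "i div (2 * t)"] show ?thesis by simp
qed

lemma fr_aut: "fr i \<in> field_auts"
proof (rule field_autsI)
  obtain e where e: "q = CHAR('a) ^ e" using q_eq_CHAR_power by blast
  show "fr i (x + y) = fr i x + fr i y" for x y
    unfolding fr_def by (rule freshmans_dream'[OF prime_CHAR, where n = "e * i"])
      (simp add: e power_mult)
  show "fr i (x * y) = fr i x * fr i y" for x y by (simp add: fr_def power_mult_distrib)
  show "fr i 1 = 1" by (simp add: fr_def)
  have "inj (fr i)"
  proof (rule injI)
    fix x y assume "fr i x = fr i y"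
    \<comment> \<open>Completing \<open>fr i\<close> by \<open>2 * t * i - i\<close> further steps
      gives \<open>fr (2 * t * i)\<close>, the identity.\<close>
    then have "fr (2 * t * i - i) (fr i x) = fr (2 * t * i - i) (fr i y)" by simp
    moreover have "2 * t * i - i + i = 2 * t * i" using t by (simp add: algebra_simps)
    moreover have "fr (2 * t * i) z = z" for z using fr_mod[of "2 * t * i" z] by simp
    ultimately show "x = y" by (simp add: fr_fr)
  qed
  then show "bij (fr i)" by (simp add: bij_def finite_UNIV_inj_surj)
qed

lemma field_aut_fr: "\<rho> \<in> field_auts \<Longrightarrow> \<rho> (fr i x) = fr i (\<rho> x)"
  by (simp add: fr_def field_auts_simps(8))

definition Q :: "'a \<Rightarrow> 'a" where "Q = fr 1"
definition P :: "'a \<Rightarrow> 'a" where "P = fr (2 * t - 1)"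
definition J :: "'a \<Rightarrow> 'a" where "J = fr t"

lemma QPJ_aut: "Q \<in> field_auts" "P \<in> field_auts" "J \<in> field_auts"
  by (auto simp: Q_def P_def J_def fr_aut)

lemmas hom_simps [simp] =
  field_auts_simps(1-9)[OF QPJ_aut(1)] field_auts_simps(1-9)[OF QPJ_aut(2)]
  field_auts_simps(1-9)[OF QPJ_aut(3)]

lemma QPJ_comm [simp]:
  "Q (P x) = x" "P (Q x) = x" "J (J x) = x" "J (Q x) = Q (J x)" "J (P x) = P (J x)"
  using t by (auto simp: Q_def P_def J_def fr_fr add.commute simp flip: mult_2)

lemma PQ_numeral [simp]: "Q (numeral m) = numeral m" "P (numeral m) = numeral m"
    "J (numeral m) = numeral m"
proof -
  have "\<rho> (of_nat m) = (of_nat m :: 'a)" if "\<rho> \<in> field_auts" for \<rho> m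
    by (induction m) (auto simp: field_auts_simps[OF that])
  from this[of _ "numeral m"] QPJ_aut show "Q (numeral m) = numeral m" "P (numeral m) = numeral m"
    "J (numeral m) = numeral m" by auto
qed

lemma field_aut_QPJ:
  assumes "\<rho> \<in> field_auts"
  shows "\<rho> (Q x) = Q (\<rho> x)" "\<rho> (P x) = P (\<rho> x)" "\<rho> (J x) = J (\<rho> x)"
  using field_aut_fr[OF assms] by (auto simp: Q_def P_def J_def)

lemma eq_via_QPJ: "Q x = Q y \<longleftrightarrow> x = y" "P x = P y \<longleftrightarrow> x = y" "J x = J y \<longleftrightarrow> x = y"
  by (metis QPJ_comm)+

text \<open>\<open>J\<close> is the \<open>t\<close>-th iterate of \<open>Q\<close>, so on elements
  fixed by the fourth iterate only \<open>t mod 4\<close> counts. This is how the residue of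
  \<open>t\<close> enters the theorem.\<close>

lemma J_eq_if_Q4:
  assumes "Q (Q (Q (Q y))) = y"
  shows "J y = (Q ^^ (t mod 4)) y"
proof -
  have fr: "(Q ^^ i) x = fr i x" for i x
    by (induction i) (auto simp: Q_def fr_fr)
  have "(Q ^^ (4 * m)) y = y" for m
  proof (induction m)
    case (Suc m)
    have "(Q ^^ (4 * Suc m)) y = (Q ^^ 4) ((Q ^^ (4 * m)) y)"
      by (metis comp_apply funpow_add mult_Suc_right)
    then show ?case using Suc assms by (simp add: eval_nat_numeral)
  qed auto
  then have "(Q ^^ (t mod 4 + 4 * (t div 4))) y = (Q ^^ (t mod 4)) y"
    by (simp only: funpow_add comp_apply)
  then show ?thesis by (simp add: fr J_def)
qed

section \<open>Linear independence of Frobenius powers\<close>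

definition lin :: "(nat \<Rightarrow> 'a) \<Rightarrow> 'a \<Rightarrow> 'a" where
  "lin c x = (\<Sum>i<2*t. c i * fr i x)"

lemma degree_q_poly: "degree (\<Sum>i<2*t. monom (c i) (q ^ i)) < q ^ (2 * t)"
proof (rule degree_sum_less)
  fix i assume "i \<in> {..<2*t}"
  then have "q ^ i < q ^ (2 * t)" using q_gt_1 by simp
  then show "degree (monom (c i) (q ^ i)) < q ^ (2 * t)"
    using degree_monom_le[of "c i"] le_less_trans by blast
qed (use q_gt_1 in simp)

lemma poly_eqI_UNIV:
  fixes f g :: "'a poly"
  assumes "\<And>x. poly f x = poly g x" "degree f < q ^ (2*t)" "degree g < q ^ (2*t)"
  shows "f = g"
  by (rule poly_eqI_degree[where A = UNIV]) (use assms card in auto)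

lemma poly_lin: "poly (\<Sum>i<2*t. monom (c i) (q ^ i)) x = lin c x"
  by (simp add: lin_def poly_sum poly_monom fr_def)

text \<open>A polynomial of degree below the size of the field is determined by its values, and the
  exponents \<open>q ^ i\<close> are distinct, so the coefficients can be read off.\<close>

lemma lin_eq_0D:
  assumes "\<And>x. lin c x = 0" "i < 2 * t"
  shows "c i = 0"
proof -
  have "(\<Sum>j<2*t. monom (c j) (q ^ j)) = 0"
    by (rule poly_eqI_UNIV) (use assms degree_q_poly q_gt_1 in \<open>auto simp: poly_lin\<close>)
  then have "coeff (\<Sum>j<2*t. monom (c j) (q ^ j)) (q ^ i) = 0" by simp
  also have "coeff (\<Sum>j<2*t. monom (c j) (q ^ j)) (q ^ i) = (\<Sum>j<2*t. if j = i then c j else 0)"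
    unfolding coeff_sum by (rule sum.cong) (use q_gt_1 in auto)
  finally show ?thesis using assms(2) by simp
qed

text \<open>These ten maps are all that occur in a code or in a composite of
  \<open>psi_map g\<close> with an element of a code. The first five coefficients belong to words in
  \<open>Q\<close> and \<open>P\<close>, the last five to the same words after
  \<open>J\<close>.\<close>

definition span10 :: "'a \<Rightarrow> 'a \<Rightarrow> 'a \<Rightarrow> 'a \<Rightarrow> 'a \<Rightarrow> 'a \<Rightarrow> 'a \<Rightarrow> 'a \<Rightarrow> 'a \<Rightarrow> 'a \<Rightarrow> 'a \<Rightarrow> 'a" where
  "span10 a0 a1 a2 a3 a4 b0 b1 b2 b3 b4 x =
     a0 * x + a1 * Q x + a2 * P x + a3 * Q (Q x) + a4 * P (P x) +
     b0 * J x + b1 * Q (J x) + b2 * P (J x) + b3 * Q (Q (J x)) + b4 * P (P (J x))"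

lemma QPJ_words:
  "x = fr 0 x" "Q x = fr 1 x" "P x = fr (2*t-1) x" "Q (Q x) = fr 2 x" "P (P x) = fr (2*t-2) x"
  "J x = fr t x" "Q (J x) = fr (t+1) x" "P (J x) = fr (t-1) x" "Q (Q (J x)) = fr (t+2) x"
  "P (P (J x)) = fr (t-2) x"
proof -
  have P: "P (fr i x) = fr (i - 1) x" if "i > 0" for i x
  proof -
    have "fr i x = Q (fr (i - 1) x)" using that by (simp add: Q_def fr_fr)
    then show ?thesis by simp
  qed
  have P': "P x = fr (2*t-1) x" by (simp add: P_def)
  show "P (P x) = fr (2*t-2) x" using P[of "2*t-1" x] P' t by (simp add: numeral_2_eq_2)
  show "P (J x) = fr (t-1) x" "P (P (J x)) = fr (t-2) x"
    using P[of t x] P[of "t-1" x] t by (auto simp: J_def numeral_2_eq_2)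
qed (auto simp: Q_def P_def J_def fr_fr numeral_2_eq_2)

text \<open>The exponents lie within distance \<open>2\<close> of \<open>0\<close> or of
  \<open>t\<close> modulo \<open>2 * t\<close>. As \<open>t > 4\<close>, these two blocks of five
  are disjoint, and \<open>lin_eq_0D\<close> applies.\<close>

lemma span10_eq_0D:
  assumes "\<And>x. span10 a0 a1 a2 a3 a4 b0 b1 b2 b3 b4 x = 0"
  shows "a0 = 0 \<and> a1 = 0 \<and> a2 = 0 \<and> a3 = 0 \<and> a4 = 0 \<and> b0 = 0 \<and> b1 = 0 \<and> b2 = 0 \<and> b3 = 0 \<and> b4 = 0"
proof -
  define ks where "ks = [0, 1, 2*t-1, 2, 2*t-2, t, t+1, t-1, t+2, t-2]"
  define c where "c = (\<lambda>i. case map_of (zip ks [a0,a1,a2,a3,a4,b0,b1,b2,b3,b4]) i of None \<Rightarrow> 0 | Some a \<Rightarrow> a)"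
  \<comment> \<open>With \<open>t = u + 5\<close> the truncated subtractions disappear, and
    distinctness of the exponents becomes plain arithmetic.\<close>
  obtain u where u: "t = u + 5" using t by (intro that[of "t - 5"]) simp
  have dist: "distinct ks" by (simp add: ks_def u)
  have c: "c 0 = a0" "c 1 = a1" "c (2*t-1) = a2" "c 2 = a3" "c (2*t-2) = a4" "c t = b0"
    "c (t+1) = b1" "c (t-1) = b2" "c (t+2) = b3" "c (t-2) = b4"
    by (simp_all add: c_def ks_def u)
  have sub: "set ks \<subseteq> {..<2*t}" using t by (auto simp: ks_def)
  have c0: "c i = 0" if "i \<notin> set ks" for i
    using that by (simp add: c_def ks_def)
  have "lin c x = (\<Sum>i\<in>set ks. c i * fr i x)" for x
    unfolding lin_def by (rule sum.mono_neutral_right) (use sub c0 in auto)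
  also have "(\<Sum>i\<in>set ks. c i * fr i x) = sum_list (map (\<lambda>i. c i * fr i x) ks)" for x
    using dist by (simp add: sum_list_distinct_conv_sum_set)
  also have "sum_list (map (\<lambda>i. c i * fr i x) ks) = span10 a0 a1 a2 a3 a4 b0 b1 b2 b3 b4 x" for x
    by (simp only: ks_def span10_def list.map sum_list.Cons sum_list.Nil c QPJ_words[symmetric])
      (simp only: add_ac add_0_left)
  finally have "lin c x = 0" for x using assms by simp
  then have "c i = 0" if "i < 2*t" for i using lin_eq_0D that by blast
  then have "\<forall>i\<in>set ks. c i = 0" using sub by blast
  then show ?thesis using c by (simp add: ks_def)
qed

lemma span10_eqD:
  assumes "\<And>x. span10 a0 a1 a2 a3 a4 b0 b1 b2 b3 b4 x = span10 a0' a1' a2' a3' a4' b0' b1' b2' b3' b4' x"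
  shows "a0 = a0' \<and> a1 = a1' \<and> a2 = a2' \<and> a3 = a3' \<and> a4 = a4' \<and>
    b0 = b0' \<and> b1 = b1' \<and> b2 = b2' \<and> b3 = b3' \<and> b4 = b4'"
  using span10_eq_0D[of "a0-a0'" "a1-a1'" "a2-a2'" "a3-a3'" "a4-a4'" "b0-b0'" "b1-b1'" "b2-b2'" "b3-b3'" "b4-b4'"]
    assms by (simp add: span10_def algebra_simps)

section \<open>Idealizers of the codes\<close>

definition psi_map :: "'a \<Rightarrow> 'a \<Rightarrow> 'a" where
  "psi_map h x = Q x + P (J x) + h * Q h * Q (J x) + h / P h * P x"

definition norm_m1 :: "'a \<Rightarrow> bool" where "norm_m1 h \<longleftrightarrow> h * J h = -1"

lemma norm_m1D: "norm_m1 h \<Longrightarrow> h \<noteq> 0" "norm_m1 h \<Longrightarrow> J h = - 1 / h"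
proof -
  show nz: "h \<noteq> 0" if "norm_m1 h" using that by (auto simp: norm_m1_def)
  show "J h = - 1 / h" if "norm_m1 h"
  proof -
    have "J h = h * J h / h" using nz[OF that] by simp
    then show ?thesis using that by (simp only: norm_m1_def)
  qed
qed

lemma psi_map_mult_span:
  "psi_map g (a * x) = span10 0 (Q a) (g / P g * P a) 0 0 0 (g * Q g * Q (J a)) (P (J a)) 0 0 x"
  by (simp add: psi_map_def span10_def algebra_simps)

text \<open>Parity separates two kinds of terms: here only words with an even number of letters
  \<open>Q\<close>, \<open>P\<close> occur, in \<open>psi_map_mult_span\<close> only words with
  exactly one. \<open>J k = - 1 / k\<close> keeps \<open>J\<close> away from the coefficients in
  \<open>k\<close>.\<close>

lemma psi_map_psi_map_span:
  assumes "norm_m1 k"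
  shows "psi_map g (b * psi_map k x) = span10
    (Q b * Q k / k + P (J b) / (P k * k) + g * Q g * Q (J b) + g / P g * P b) 0 0
    (Q b + g * Q g * Q (J b) / (Q k * Q (Q k))) (P (J b) + g / P g * P k / P (P k) * P b)
    (Q b + P (J b) + g * Q g * (k / Q k) * Q (J b) + g / P g * P k * k * P b) 0 0
    (Q b * Q k * Q (Q k) + g * Q g * Q (J b)) (P (J b) * P (P k) / P k + g / P g * P b) x"
  proof -
  have k: "k \<noteq> 0" and Jk: "J k = - 1 / k" using norm_m1D[OF assms] by auto
  have Q: "Q (psi_map k x) = Q (Q x) + J x + Q k * Q (Q k) * Q (Q (J x)) + Q k / k * x"
    and P: "P (psi_map k x) = x + P (P (J x)) + P k * k * J x + P k / P (P k) * P (P x)"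
    and QJ: "Q (J (psi_map k x)) = Q (Q (J x)) + x + 1 / (Q k * Q (Q k)) * Q (Q x) + k / Q k * J x"
    and PJ: "P (J (psi_map k x)) = J x + P (P x) + 1 / (P k * k) * x + P (P k) / P k * P (P (J x))"
    by (auto simp: psi_map_def Jk)
  show ?thesis
    by (subst psi_map_def) (simp add: Q P QJ PJ span10_def distrib_left distrib_right add_ac mult_ac)
qed

lemma psi_map_add: "psi_map h (x + y) = psi_map h x + psi_map h y"
  by (simp add: psi_map_def algebra_simps)

lemma psi_map_minus [simp]: "psi_map (- h) x = psi_map h x"
  by (simp add: psi_map_def)

lemma norm_m1_aut: "\<rho> \<in> field_auts \<Longrightarrow> norm_m1 h \<Longrightarrow> norm_m1 (\<rho> h)"
  by (metis (no_types, lifting) field_aut_QPJ(3) field_auts_simps(2,4,5) norm_m1_def)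

lemma psi_map_aut:
  assumes "\<rho> \<in> field_auts"
  shows "\<rho> (psi_map h x) = psi_map (\<rho> h) (\<rho> x)"
  by (simp add: psi_map_def field_auts_simps[OF assms] field_aut_QPJ[OF assms])

section \<open>Relations between \<open>J\<close> and \<open>Q\<close> on elements of special
  norm\<close>

lemma t_mod_4: "t mod 4 \<in> {0, 1, 2, 3}"
  by auto

lemma J_cases:
  assumes "Q (Q (Q (Q y))) = y"
  shows "t mod 4 = 0 \<Longrightarrow> J y = y" "t mod 4 = 1 \<Longrightarrow> J y = Q y"
    "t mod 4 = 2 \<Longrightarrow> J y = Q (Q y)" "t mod 4 = 3 \<Longrightarrow> J y = Q (Q (Q y))"
  using J_eq_if_Q4[OF assms] by (simp_all add: numeral_2_eq_2 numeral_3_eq_3)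

lemma Q4_eq:
  assumes "l * Q (Q l) = 1"
  shows "Q (Q (Q (Q l))) = l"
proof -
  have "Q (Q l) * Q (Q (Q (Q l))) = 1"
    using arg_cong[OF assms, of "\<lambda>x. Q (Q x)"] by simp
  then show ?thesis using assms by (metis mult.commute mult_right_cancel mult_zero_left zero_neq_one)
qed

text \<open>Both \<open>J l\<close> and \<open>Q (Q l)\<close> are the inverse of \<open>l\<close>,
  while \<open>J l\<close> is \<open>l\<close>, \<open>Q l\<close> or \<open>Q (Q (Q l))\<close>
  according to \<open>t mod 4\<close>. In the first case \<open>l * J l = 1\<close> is already the
  claim, in the other two \<open>Q l = l\<close> follows. The excluded residue gives
  \<open>J l = Q (Q l)\<close> and no information.\<close>

lemma square_eq_1_of_norms:
  assumes "l * Q (Q l) = 1" "l * J l = 1" "t mod 4 \<noteq> 2"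
  shows "l\<^sup>2 = 1"
proof -
  have J: "J l = Q (Q l)" using assms(1,2) by (metis mult_left_cancel mult_zero_left zero_neq_one)
  have Q1: "Q l = l \<Longrightarrow> ?thesis" using assms(1) by (simp add: power2_eq_square)
  consider "t mod 4 = 0" | "t mod 4 = 1" | "t mod 4 = 3" using t_mod_4 assms(3) by auto
  then show ?thesis
  proof cases
    case 1
    then show ?thesis using J_cases(1)[OF Q4_eq[OF assms(1)]] assms(2) by (simp add: power2_eq_square)
  next
    case 2
    then have "Q l = Q (Q l)" using J_cases(2)[OF Q4_eq[OF assms(1)]] J by simp
    then show ?thesis using Q1 by (simp add: eq_via_QPJ)
  next
    case 3
    then have "Q (Q (Q l)) = Q (Q l)" using J_cases(4)[OF Q4_eq[OF assms(1)]] J by simp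
    then show ?thesis using Q1 by (simp add: eq_via_QPJ)
  qed
qed

text \<open>\<open>Q h\<close> is again a square root of \<open>-1\<close>, so it is
  \<open>h\<close> or \<open>- h\<close>, and a second application restores
  \<open>h\<close>.\<close>

lemma Q2_fixed_of_square_m1:
  assumes "h\<^sup>2 = -1"
  shows "Q (Q h) = h"
proof -
  have "(Q h)\<^sup>2 = Q (h\<^sup>2)" by simp
  also have "\<dots> = h\<^sup>2" unfolding assms by simp
  finally have "Q h = h \<or> Q h = - h" by (simp add: power2_eq_iff)
  then show ?thesis by auto
qed

lemma square_eq_1D: "(x :: 'a)\<^sup>2 = 1 \<Longrightarrow> Q x = x"
  by (auto simp: power2_eq_1_iff)

lemma norm_m1_square_neq_1:
  assumes "norm_m1 h"
  shows "h\<^sup>2 \<noteq> 1"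
proof
  assume "h\<^sup>2 = 1"
  then have "h = 1 \<or> h = -1" by (simp add: power2_eq_1_iff)
  then have "h * J h = 1" by auto
  then show False using assms eq_minus_self_iff(1)[of 1] by (simp add: norm_m1_def)
qed

text \<open>This keeps the denominators in \<open>idealizer_coeff\<close> and its conjugates from
  vanishing. If the product were \<open>1\<close>, then \<open>J h = - Q (Q h)\<close> and the
  fourth iterate of \<open>Q\<close> would fix \<open>h\<close>; every residue of \<open>t\<close>
  modulo \<open>4\<close> then makes \<open>Q (Q h) = h\<close>, hence \<open>h ^ 2 = 1\<close>, or
  \<open>h = 0\<close>.\<close>

lemma norm_m1_Q2_neq_1:
  assumes h: "norm_m1 h"
  shows "h * Q (Q h) \<noteq> 1"
proof
  assume 1: "h * Q (Q h) = 1"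
  have h0: "h \<noteq> 0" using norm_m1D[OF h] by simp
  have J: "J h = - Q (Q h)"
  proof -
    have "h * J h = h * (- Q (Q h))" using h 1 by (simp add: norm_m1_def)
    then show ?thesis using h0 by (simp only: mult_cancel_left) simp
  qed
  have fix2: "Q (Q h) \<noteq> h" using 1 norm_m1_square_neq_1[OF h] by (auto simp: power2_eq_square)
  consider "t mod 4 = 0" | "t mod 4 = 1" | "t mod 4 = 2" | "t mod 4 = 3" using t_mod_4 by auto
  then show False
  proof cases
    case 1
    then have "J h = h" using J_cases(1)[OF Q4_eq[OF \<open>h * Q (Q h) = 1\<close>]] by simp
    then have "h\<^sup>2 = -1" using h by (simp add: norm_m1_def power2_eq_square)
    then show False using Q2_fixed_of_square_m1 fix2 by blast
  next
    case 2
    then have "- Q (Q h) = Q h" using J_cases(2)[OF Q4_eq[OF \<open>h * Q (Q h) = 1\<close>]] J by simp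
    then have "Q (Q h) = Q (- h)" by (simp add: minus_equation_iff)
    then have "Q h = - h" by (simp only: eq_via_QPJ)
    then show False using fix2 by simp
  next
    case 3
    then have "J h = Q (Q h)" using J_cases(3)[OF Q4_eq[OF \<open>h * Q (Q h) = 1\<close>]] by simp
    then have "Q (Q h) = 0" using J eq_minus_self_iff by metis
    then show False using h0 by simp
  next
    case 4
    then have "Q (Q (Q h)) = Q (Q (- h))"
      using J_cases(4)[OF Q4_eq[OF \<open>h * Q (Q h) = 1\<close>]] J by simp
    then have "Q h = - h" by (simp only: eq_via_QPJ)
    then show False using fix2 by simp
  qed
qed

section \<open>Codes as sets of maps and their left idealizer\<close>

definition code_maps :: "'a \<Rightarrow> ('a \<Rightarrow> 'a) set" where
  "code_maps h = {\<lambda>x. a * x + b * psi_map h x | a b. True}"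

lemma code_maps_iff: "\<phi> \<in> code_maps h \<longleftrightarrow> (\<exists>a b. \<forall>x. \<phi> x = a * x + b * psi_map h x)"
  by (auto simp: code_maps_def)

lemma id_in_code_maps: "id \<in> code_maps h" and psi_map_in_code_maps: "psi_map h \<in> code_maps h"
  unfolding code_maps_iff by (rule exI[of _ 1], rule exI[of _ 0], simp) (rule exI[of _ 0], rule exI[of _ 1], simp)

lemma code_maps_span: "a * x + b * psi_map h x = span10 a b (b * (h / P h)) 0 0 0 (b * (h * Q h)) b 0 0 x"
  by (simp add: psi_map_def span10_def algebra_simps)

text \<open>Applied to \<open>id\<close>, the hypothesis puts \<open>\<phi>\<close> into the code.
  Were the coefficient \<open>b\<close> of \<open>psi_map h\<close> nonzero, composition with
  \<open>psi_map h\<close> would force \<open>h ^ 2 = -1\<close> by the term in \<open>J x\<close>,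
  so \<open>Q (Q h) = h\<close>, and then the term in \<open>Q (Q x)\<close> would have the nonzero
  coefficient \<open>2 * b\<close>.\<close>

lemma code_maps_left_idealizer:
  assumes h: "norm_m1 h" and \<phi>: "\<And>\<xi>. \<xi> \<in> code_maps h \<Longrightarrow> \<phi> \<circ> \<xi> \<in> code_maps h"
  shows "\<exists>a. \<forall>x. \<phi> x = a * x"
proof -
  obtain a b where ab: "\<phi> x = a * x + b * psi_map h x" for x
    using \<phi>[OF id_in_code_maps] by (auto simp: code_maps_iff)
  obtain a' b' where "\<phi> (psi_map h x) = a' * x + b' * psi_map h x" for x
    using \<phi>[OF psi_map_in_code_maps] by (auto simp: code_maps_iff)
  \<comment> \<open>The factor \<open>1\<close> matches the form \<open>b * psi_map k x\<close> in
    \<open>psi_map_psi_map_span\<close>.\<close>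
  then have eq: "b * psi_map h (1 * psi_map h x) = a' * x + (b' - a) * psi_map h x" for x
    by (simp add: ab algebra_simps)
  have h0: "h \<noteq> 0" using norm_m1D[OF h] by simp
  have "b * span10 c0 c1 c2 c3 c4 d0 d1 d2 d3 d4 x =
      span10 (b*c0) (b*c1) (b*c2) (b*c3) (b*c4) (b*d0) (b*d1) (b*d2) (b*d3) (b*d4) x"
    for c0 c1 c2 c3 c4 d0 d1 d2 d3 d4 x
    by (simp add: span10_def algebra_simps)
  note span10_eqD[OF eq[unfolded psi_map_psi_map_span[OF h] code_maps_span this]]
  then have QQ: "b * (1 + h / Q (Q h)) = 0" and J: "b * (2 + 2 * h\<^sup>2) = 0"
    using h0 by (simp_all add: power2_eq_square field_simps)
  have "b = 0"
  proof (rule ccontr)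
    assume b: "b \<noteq> 0"
    have "b * (2 * (1 + h\<^sup>2)) = 0" using J by (simp add: distrib_left)
    then have "1 + h\<^sup>2 = 0" using b two_neq_0 by (simp only: mult_eq_0_iff) simp
    then have "h\<^sup>2 = -1" by (simp add: eq_neg_iff_add_eq_0 add.commute)
    then have "Q (Q h) = h" by (rule Q2_fixed_of_square_m1)
    then show False using QQ b h0 two_neq_0 by simp
  qed
  then show ?thesis using ab by auto
qed

section \<open>Right multiplication from one code to another\<close>

text \<open>In \<open>psi_map g \<circ> w\<close> the coefficient \<open>a\<close> yields only words
  with one letter from \<open>Q\<close>, \<open>P\<close>, and \<open>b\<close> only even words, so
  the conditions separate. The part from \<open>a\<close> must be the multiple \<open>Q a\<close> of
  \<open>psi_map k\<close>; the coefficients of \<open>Q (Q x)\<close>, \<open>P (P x)\<close> and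
  \<open>J x\<close> must vanish.\<close>

lemma code_maps_right_conditions:
  assumes g: "norm_m1 g" and k: "norm_m1 k" and w: "w \<in> code_maps k" "psi_map g \<circ> w \<in> code_maps k"
  obtains a b where "\<And>x. w x = a * x + b * psi_map k x"
    "Q a = P (J a)" "g * Q g * Q (J a) = k * Q k * Q a" "g / P g * P a = k / P k * Q a"
    "Q b + g * Q g * Q (J b) / (Q k * Q (Q k)) = 0"
    "P (J b) + g / P g * P k / P (P k) * P b = 0"
    "Q b + P (J b) + g * Q g * (k / Q k) * Q (J b) + g / P g * P k * k * P b = 0"
proof -
  obtain a b where ab: "w x = a * x + b * psi_map k x" for x
    using w(1) by (auto simp: code_maps_iff)
  obtain a' b' where ab': "psi_map g (w x) = a' * x + b' * psi_map k x" for x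
    using w(2) by (auto simp: code_maps_iff)
  have add: "span10 c0 c1 c2 c3 c4 d0 d1 d2 d3 d4 x + span10 c0' c1' c2' c3' c4' d0' d1' d2' d3' d4' x
     = span10 (c0+c0') (c1+c1') (c2+c2') (c3+c3') (c4+c4') (d0+d0') (d1+d1') (d2+d2') (d3+d3') (d4+d4') x"
    for c0 c1 c2 c3 c4 d0 d1 d2 d3 d4 c0' c1' c2' c3' c4' d0' d1' d2' d3' d4' x
    by (simp add: span10_def algebra_simps)
  have eq: "psi_map g (a * x) + psi_map g (b * psi_map k x) = a' * x + b' * psi_map k x" for x
    using ab'[of x] by (simp add: ab psi_map_add)
  note eqs = span10_eqD[OF eq[unfolded psi_map_psi_map_span[OF k] code_maps_span, unfolded psi_map_mult_span add]]
  show ?thesis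
    by (rule that[OF ab]) (use eqs in \<open>simp_all add: mult.commute\<close>)
qed

text \<open>Since \<open>w\<close> is not zero, \<open>a\<close> or \<open>b\<close> is nonzero;
  from the conditions on either one, eliminating \<open>J\<close> leaves the same relation between
  \<open>g\<close> and \<open>k\<close>.\<close>

lemma code_maps_right_Q2:
  assumes g: "norm_m1 g" and k: "norm_m1 k" and w: "w \<in> code_maps k" "psi_map g \<circ> w \<in> code_maps k" "w x \<noteq> 0"
  shows "g * Q (Q g) = k * Q (Q k)"
proof -
  obtain a b where ab: "\<And>x. w x = a * x + b * psi_map k x"
    and a: "Q a = P (J a)" "g * Q g * Q (J a) = k * Q k * Q a" "g / P g * P a = k / P k * Q a"
    and b: "Q b + g * Q g * Q (J b) / (Q k * Q (Q k)) = 0"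
      "P (J b) + g / P g * P k / P (P k) * P b = 0"
    using code_maps_right_conditions[OF g k w(1,2)] by metis
  have nz: "g \<noteq> 0" "k \<noteq> 0" using norm_m1D g k by auto
  have "a \<noteq> 0 \<or> b \<noteq> 0" using ab w(3) by auto
  then show ?thesis
  proof
    assume "b \<noteq> 0"
    \<comment> \<open>Applying \<open>Q\<close> twice to the second condition expresses
      \<open>Q (J b)\<close> by \<open>Q b\<close>, ready for substitution into the first.\<close>
    have "Q (J b) = - (Q (Q g) / Q g * Q k / k * Q b)"
      using arg_cong[OF b(2), of "\<lambda>x. Q (Q x)"] by (simp add: eq_neg_iff_add_eq_0)
    then have "Q b + g * Q g * (- (Q (Q g) / Q g * Q k / k * Q b)) / (Q k * Q (Q k)) = 0"
      using b(1) by (simp only:)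
    also have "Q b + g * Q g * (- (Q (Q g) / Q g * Q k / k * Q b)) / (Q k * Q (Q k)) =
        Q b * (1 - g * Q (Q g) / (k * Q (Q k)))"
      using nz by (simp add: field_simps)
    finally have "Q b * (1 - g * Q (Q g) / (k * Q (Q k))) = 0" .
    then have "1 - g * Q (Q g) / (k * Q (Q k)) = 0" using \<open>b \<noteq> 0\<close> by simp
    then show ?thesis using nz by (simp add: field_simps)
  next
    assume "a \<noteq> 0"
    have J: "J a = Q (Q a)" using arg_cong[OF a(1), of Q] by simp
    have "Q (Q g) / Q g * Q a = Q (Q k) / Q k * Q (Q (Q a))"
      using arg_cong[OF a(3), of "\<lambda>x. Q (Q x)"] by simp
    then have "Q (Q (Q a)) = Q (Q g) * Q k / (Q g * Q (Q k)) * Q a"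
      using nz by (simp add: field_simps)
    then have "g * Q g * (Q (Q g) * Q k / (Q g * Q (Q k)) * Q a) = k * Q k * Q a"
      using a(2) by (simp only: J)
    then show ?thesis using \<open>a \<noteq> 0\<close> nz by (simp add: field_simps)
  qed
qed

section \<open>The right idealizer\<close>

text \<open>For odd \<open>t\<close> the conditions on \<open>b\<close> in
  \<open>code_maps_right_conditions\<close> with \<open>g = k = h\<close> are solved exactly by the
  multiples \<open>c * idealizer_coeff h\<close> with \<open>Q c = - c\<close>.\<close>

definition idealizer_coeff :: "'a \<Rightarrow> 'a" where "idealizer_coeff h = - P h / (P h * Q h - 1)"

text \<open>The right idealizer of \<open>code_maps h\<close> is a field of order \<open>q\<^sup>2\<close>. For even \<open>t\<close> it consists of
  the scalars in that subfield. For odd \<open>t\<close> only the scalars from the field of order \<open>q\<close> occur, and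
  the rest comes from the maps \<open>c * idealizer_coeff h * psi_map h\<close> with \<open>Q c = - c\<close>, whose squares
  are the scalars \<open>c\<^sup>2\<close>.\<close>

definition idealizer_map :: "'a \<Rightarrow> 'a \<Rightarrow> 'a \<Rightarrow> 'a" where
  "idealizer_map h z x = (if even t then z * x
     else (z + Q z) / 2 * x + (z - Q z) / 2 * idealizer_coeff h * psi_map h x)"

lemma P_eq_Q: "Q (Q z) = z \<Longrightarrow> P z = Q z"
  by (metis QPJ_comm(2))

lemma J_Q2:
  assumes "Q (Q z) = z"
  shows "J z = (if even t then z else Q z)"
proof -
  have 4: "Q (Q (Q (Q z))) = z" using assms by simp
  consider "t mod 4 = 0" "even t" | "t mod 4 = 1" "odd t" | "t mod 4 = 2" "even t" | "t mod 4 = 3" "odd t"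
    using t_mod_4 even_even_mod_4_iff[of t] by auto
  then show ?thesis by cases (use J_cases[OF 4] assms in auto)
qed

lemma norm_m1_denom:
  assumes "norm_m1 h"
  shows "h * Q (Q h) - 1 \<noteq> 0" "h * P (P h) - 1 \<noteq> 0" "P h * Q h - 1 \<noteq> 0"
proof -
  show 1: "h * Q (Q h) - 1 \<noteq> 0" using norm_m1_Q2_neq_1[OF assms] by simp
  show "h * P (P h) - 1 \<noteq> 0"
  proof
    assume "h * P (P h) - 1 = 0"
    then have "Q (Q (h * P (P h) - 1)) = 0" by simp
    then show False using 1 by (simp add: mult.commute)
  qed
  show "P h * Q h - 1 \<noteq> 0"
  proof
    assume "P h * Q h - 1 = 0"
    then have "Q (P h * Q h - 1) = 0" by simp
    then show False using 1 by simp
  qed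
qed

text \<open>With \<open>b = c * idealizer_coeff h\<close> in \<open>psi_map_psi_map_span\<close>,
  every coefficient but that of \<open>x\<close> cancels. \<open>D\<close> and \<open>E\<close> are
  the denominators of \<open>Q b\<close> and \<open>P b\<close>.\<close>

lemma psi_map_idealizer_coeff_psi_map:
  assumes h: "norm_m1 h" and t: "odd t" and c: "Q c = - c"
  shows "psi_map h (c * idealizer_coeff h * psi_map h x) = c / idealizer_coeff h * x"
proof -
  have h0: "h \<noteq> 0" and Jh: "J h = - 1 / h" using norm_m1D[OF h] by auto
  define D E where "D = h * Q (Q h) - 1" and "E = h * P (P h) - 1"
  have DE: "D \<noteq> 0" "E \<noteq> 0" using norm_m1_denom[OF h] by (auto simp: D_def E_def)
  have c2: "Q (Q c) = c" using c by simp
  have Jc: "J c = - c" and Pc: "P c = - c" using J_Q2[OF c2] P_eq_Q[OF c2] t c by auto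
  define b where "b = c * idealizer_coeff h"
  have Qb: "Q b = c * h / D"
    by (simp add: b_def idealizer_coeff_def c D_def)
  have Pb: "P b = c * P (P h) / E"
    by (simp add: b_def idealizer_coeff_def Pc E_def mult.commute)
  have "J b = - c * (1 / P h) / (1 / (P h * Q h) - 1)"
    by (simp add: b_def idealizer_coeff_def Jc Jh)
  also have "\<dots> = - c * Q h / (1 - P h * Q h)"
    using h0 norm_m1_denom(3)[OF h] by (simp add: divide_simps)
  finally have Jb: "J b = c * Q h / (P h * Q h - 1)"
    by (metis minus_diff_eq minus_divide_divide minus_mult_left minus_minus)
  have QJb: "Q (J b) = - c * Q (Q h) / D" by (simp add: Jb c D_def)
  have PJb: "P (J b) = - c * h / E" by (simp add: Jb Pc E_def mult.commute)
  have D: "h * Q (Q h) = D + 1" and E: "h * P (P h) = E + 1" by (auto simp: D_def E_def)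
  have x: "Q b * Q h / h + P (J b) / (P h * h) + h * Q h * Q (J b) + h / P h * P b = c / idealizer_coeff h"
  proof -
    have "Q b * Q h / h + P (J b) / (P h * h) + h * Q h * Q (J b) + h / P h * P b
        = c * Q h / D - c / (E * P h) - c * Q h * (h * Q (Q h)) / D + c * (h * P (P h)) / (P h * E)"
      using h0 by (simp add: Qb Pb QJb PJb mult_ac)
    also have "\<dots> = c * (1 / P h - Q h)"
      using DE h0 unfolding D E by (simp add: field_simps)
    also have "\<dots> = c / idealizer_coeff h"
      using h0 norm_m1_denom(3)[OF h] by (simp add: idealizer_coeff_def field_simps)
    finally show ?thesis .
  qed
  have QQ: "Q b + h * Q h * Q (J b) / (Q h * Q (Q h)) = 0"
    using h0 DE by (simp add: Qb QJb)
  have PP: "P (J b) + h / P h * P h / P (P h) * P b = 0"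
    using h0 DE by (simp add: Pb PJb)
  have J: "Q b + P (J b) + h * Q h * (h / Q h) * Q (J b) + h / P h * P h * h * P b = 0"
  proof -
    have "Q b + P (J b) + h * Q h * (h / Q h) * Q (J b) + h / P h * P h * h * P b =
       c * h / D - c * h / E - c * h * (h * Q (Q h)) / D + c * h * (h * P (P h)) / E"
      using h0 by (simp add: Qb Pb QJb PJb mult_ac)
    also have "\<dots> = 0"
      using DE h0 unfolding D E by (simp add: field_simps)
    finally show ?thesis .
  qed
  have QQJ: "Q b * Q h * Q (Q h) + h * Q h * Q (J b) = 0"
    by (simp add: Qb QJb)
  have PPJ: "P (J b) * P (P h) / P h + h / P h * P b = 0"
    by (simp add: Pb PJb mult_ac)
  have "psi_map h (b * psi_map h x) = span10 (c / idealizer_coeff h) 0 0 0 0 0 0 0 0 0 x"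
    unfolding psi_map_psi_map_span[OF h] by (simp only: x QQ PP J QQJ PPJ)
  then show ?thesis by (simp add: b_def span10_def)
qed

lemma psi_map_fixed_mult:
  assumes "Q a = a"
  shows "psi_map h (a * x) = a * psi_map h x"
proof -
  have "P a = a" "J a = a" using P_eq_Q[of a] J_Q2[of a] assms by auto
  then show ?thesis using assms by (simp add: psi_map_def algebra_simps)
qed

lemma idealizer_coeff_nz: "norm_m1 h \<Longrightarrow> idealizer_coeff h \<noteq> 0"
  using norm_m1D(1) norm_m1_denom(3) by (simp add: idealizer_coeff_def)

text \<open>On the field of order \<open>q ^ 2\<close> the map \<open>Q\<close> is an involution;
  the halves are the components for its eigenvalues \<open>1\<close> and \<open>-1\<close>.\<close>

lemma half_parts:
  assumes "Q (Q z) = z"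
  shows "Q ((z + Q z) / 2) = (z + Q z) / 2" "Q ((z - Q z) / 2) = - ((z - Q z) / 2)"
    "z = (z + Q z) / 2 + (z - Q z) / 2"
proof -
  show "Q ((z + Q z) / 2) = (z + Q z) / 2" "Q ((z - Q z) / 2) = - ((z - Q z) / 2)"
    using assms two_neq_0 by (auto simp: field_simps)
  have "(z + Q z) / 2 + (z - Q z) / 2 = 2 * z / 2" by (simp add: add_divide_distrib[symmetric])
  then show "z = (z + Q z) / 2 + (z - Q z) / 2" using two_neq_0 by simp
qed

lemma idealizer_map_split:
  assumes "odd t" "Q a = a" "Q c = - c"
  shows "idealizer_map h (a + c) x = a * x + c * idealizer_coeff h * psi_map h x"
proof -
  have "(a + c + Q (a + c)) / 2 = a" "(a + c - Q (a + c)) / 2 = c"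
    using assms two_neq_0 by (auto simp: field_simps)
  then show ?thesis using assms by (simp only: idealizer_map_def if_False)
qed

lemma Q2_split:
  assumes "Q (Q z) = z"
  obtains a c where "z = a + c" "Q a = a" "Q c = - c"
  using half_parts[OF assms] that by blast

text \<open>For odd \<open>t\<close>, scalars fixed by \<open>Q\<close> commute with
  \<open>psi_map h\<close>, and composing the parts belonging to \<open>c\<close> and
  \<open>c'\<close> gives the scalar \<open>c * c'\<close> by
  \<open>psi_map_idealizer_coeff_psi_map\<close>. So composition multiplies \<open>a + c\<close> and
  \<open>a' + c'\<close> as in the field.\<close>

lemma idealizer_map_mult:
  assumes h: "norm_m1 h" and z: "Q (Q z) = z" and y: "Q (Q y) = y"
  shows "idealizer_map h z (idealizer_map h y x) = idealizer_map h (z * y) x"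
proof (cases "even t")
  case False
  obtain a c where z: "z = a + c" "Q a = a" "Q c = - c" using Q2_split[OF z] by blast
  obtain a' c' where y: "y = a' + c'" "Q a' = a'" "Q c' = - c'" using Q2_split[OF y] by blast
  have zy: "z * y = (a * a' + c * c') + (a * c' + c * a')" by (simp add: z y algebra_simps)
  have "idealizer_map h (z * y) x = (a * a' + c * c') * x + (a * c' + c * a') * idealizer_coeff h * psi_map h x"
    unfolding zy by (rule idealizer_map_split) (use False z y in auto)
  moreover have "psi_map h (idealizer_map h y x) = a' * psi_map h x + c' / idealizer_coeff h * x"
    unfolding y(1) idealizer_map_split[OF False y(2,3)]
    by (simp add: psi_map_add psi_map_fixed_mult y psi_map_idealizer_coeff_psi_map[OF h False])
  ultimately show ?thesis
    unfolding z(1) y(1) idealizer_map_split[OF False z(2,3)] using idealizer_coeff_nz[OF h]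
    by (simp add: idealizer_map_split[OF False y(2,3)] y(1)[symmetric]) (simp add: y(1) idealizer_map_split[OF False y(2,3)] algebra_simps)
qed (simp add: idealizer_map_def)

lemma idealizer_map_1: "idealizer_map h 1 x = x"
  using two_neq_0 by (simp add: idealizer_map_def)

lemma idealizer_map_in_code_maps: "idealizer_map h z \<in> code_maps h"
proof (cases "even t")
  case True
  then show ?thesis unfolding code_maps_iff
    by (intro exI[of _ z] exI[of _ 0]) (simp add: idealizer_map_def)
next
  case False
  then show ?thesis unfolding code_maps_iff
    by (intro exI[of _ "(z + Q z) / 2"] exI[of _ "(z - Q z) / 2 * idealizer_coeff h"]) (simp add: idealizer_map_def)
qed

lemma idealizer_map_inverse:
  assumes h: "norm_m1 h" and z: "Q (Q z) = z" "z \<noteq> 0"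
  shows "idealizer_map h z (idealizer_map h (1 / z) x) = x" "idealizer_map h (1 / z) (idealizer_map h z x) = x"
proof -
  have "Q (Q (1 / z)) = 1 / z" using z by simp
  then show "idealizer_map h z (idealizer_map h (1 / z) x) = x" "idealizer_map h (1 / z) (idealizer_map h z x) = x"
    using idealizer_map_mult[OF h] z by (simp_all add: idealizer_map_1)
qed

lemma psi_map_idealizer_map_in_code_maps:
  assumes h: "norm_m1 h" and z: "Q (Q z) = z"
  shows "psi_map h \<circ> idealizer_map h z \<in> code_maps h"
proof (cases "even t")
  case True
  have "P z = Q z" "J z = z" using P_eq_Q[OF z] J_Q2[OF z] True by auto
  then have "psi_map h (z * x) = Q z * psi_map h x" for x by (simp add: psi_map_def z algebra_simps)
  then show ?thesis
    unfolding code_maps_iff by (intro exI[of _ 0] exI[of _ "Q z"]) (simp add: idealizer_map_def True)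
next
  case False
  obtain a c where z: "z = a + c" "Q a = a" "Q c = - c" using Q2_split[OF z] by blast
  have "psi_map h (idealizer_map h z x) = a * psi_map h x + c / idealizer_coeff h * x" for x
    unfolding z(1) idealizer_map_split[OF False z(2,3)]
    by (simp add: psi_map_add psi_map_fixed_mult z psi_map_idealizer_coeff_psi_map[OF h False])
  then show ?thesis
    unfolding code_maps_iff by (intro exI[of _ "c / idealizer_coeff h"] exI[of _ a]) simp
qed

lemma inj_on_idealizer_map:
  assumes h: "norm_m1 h" and z: "Q (Q z) = z" and y: "Q (Q y) = y" and eq: "\<And>x. idealizer_map h z x = idealizer_map h y x"
  shows "z = y"
proof (cases "even t")
  case True
  then show ?thesis using eq[of 1] by (simp add: idealizer_map_def)
next
  case False
  obtain a c where z: "z = a + c" "Q a = a" "Q c = - c" using Q2_split[OF z] by blast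
  obtain a' c' where y: "y = a' + c'" "Q a' = a'" "Q c' = - c'" using Q2_split[OF y] by blast
  have eq: "a * x + c * idealizer_coeff h * psi_map h x = a' * x + c' * idealizer_coeff h * psi_map h x" for x
    using eq[of x] unfolding z(1) y(1) idealizer_map_split[OF False z(2,3)] idealizer_map_split[OF False y(2,3)] .
  show ?thesis
    using span10_eqD[OF eq[unfolded code_maps_span]] idealizer_coeff_nz[OF h] by (simp add: z y)
qed

text \<open>The conditions on the coefficient \<open>b\<close> of \<open>psi_map h\<close> say that
  \<open>m = Q b * (h * Q (Q h) - 1) / h\<close> satisfies \<open>Q (Q m) = m\<close> and \<open>J m = - m\<close>; for even \<open>t\<close> this
  forces \<open>m = 0\<close>.\<close>

lemma code_maps_right_idealizer:
  assumes h: "norm_m1 h" and w: "w \<in> code_maps h" "psi_map h \<circ> w \<in> code_maps h" "w x0 \<noteq> 0"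
  shows "\<exists>z. Q (Q z) = z \<and> z \<noteq> 0 \<and> w = idealizer_map h z"
proof -
  obtain a b where ab: "\<And>x. w x = a * x + b * psi_map h x"
    and a: "Q a = P (J a)" "h * Q h * Q (J a) = h * Q h * Q a" "h / P h * P a = h / P h * Q a"
    and b: "Q b + h * Q h * Q (J b) / (Q h * Q (Q h)) = 0"
      "P (J b) + h / P h * P h / P (P h) * P b = 0"
      "Q b + P (J b) + h * Q h * (h / Q h) * Q (J b) + h / P h * P h * h * P b = 0"
    using code_maps_right_conditions[OF h h w(1,2)] by metis
  have h0: "h \<noteq> 0" and Jh: "J h = - 1 / h" using norm_m1D[OF h] by auto
  have Ja: "J a = a" using a(2) h0 by (simp add: eq_via_QPJ)
  have "P a = Q a" using a(3) h0 by simp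
  then have QQa: "Q (Q a) = a" by (metis QPJ_comm(1))
  define m where "m = Q b * (h * Q (Q h) - 1) / h"
  have QJb: "Q (J b) = - (Q (Q h) / h * Q b)"
    using b(1) h0 by (simp add: field_simps eq_neg_iff_add_eq_0)
  have PJb: "P (J b) = - (h / P (P h) * P b)"
    using b(2) h0 by (simp add: eq_neg_iff_add_eq_0)
  \<comment> \<open>Removing \<open>J b\<close> from the vanishing coefficient of \<open>J x\<close>
    leaves an equation between \<open>P b\<close> and \<open>Q b\<close>, which says
    \<open>P (P m) = m\<close>.\<close>
  have "Q b + - (h / P (P h) * P b) + h * Q h * (h / Q h) * (- (Q (Q h) / h * Q b)) + h / P h * P h * h * P b = 0"
    using b(3) by (simp only: QJb PJb)
  then have "P b * (h * P (P h) - 1) / P (P h) = m"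
    using h0 by (simp add: m_def field_simps)
  moreover have "P (P m) = P b * (h * P (P h) - 1) / P (P h)"
    by (simp add: m_def mult.commute)
  ultimately have PPm: "P (P m) = m" by simp
  then have QQm: "Q (Q m) = m" by (metis QPJ_comm(1))
  have "J m = Q (J b) * (1 / (h * Q (Q h)) - 1) * (- h)"
    by (simp add: m_def Jh)
  also have "\<dots> = - m" unfolding QJb using h0 by (simp add: m_def field_simps)
  finally have Jm: "J m = - m" .
  have bm: "b = P m * P h / (P h * Q h - 1)"
    using h0 norm_m1_denom(3)[OF h] by (simp add: m_def)
  show ?thesis
  proof (cases "even t")
    case True
    then have "m = 0" using J_Q2[OF QQm] Jm eq_minus_self_iff by simp
    then have "b = 0" by (simp add: bm)
    then have wa: "w x = a * x" for x by (simp add: ab)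
    then have "w = idealizer_map h a" using True by (auto simp: idealizer_map_def)
    moreover have "a \<noteq> 0" using wa w(3) by auto
    ultimately show ?thesis using QQa by blast
  next
    case False
    have "Q m = - m" using J_Q2[OF QQm] Jm False by simp
    then have Pm: "P m = - m" using P_eq_Q[OF QQm] by simp
    have Qa: "Q a = a" using J_Q2[OF QQa] Ja False by simp
    have "b = m * idealizer_coeff h" using bm Pm by (simp add: idealizer_coeff_def)
    then have wz: "w = idealizer_map h (a + m)"
      using idealizer_map_split[OF False Qa \<open>Q m = - m\<close>] ab by auto
    moreover have "Q (Q (a + m)) = a + m" using QQa QQm by simp
    moreover have "a + m \<noteq> 0"
    proof
      assume "a + m = 0"
      then have "w x0 = 0" using wz by (simp add: idealizer_map_def)
      then show False using w(3) by simp
    qed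
    ultimately show ?thesis by blast
  qed
qed

lemma idealizer_coeff_aut: "\<rho> \<in> field_auts \<Longrightarrow> \<rho> (idealizer_coeff h) = idealizer_coeff (\<rho> h)"
  by (simp add: idealizer_coeff_def field_auts_simps field_aut_QPJ)

lemma idealizer_map_aut:
  assumes "\<rho> \<in> field_auts"
  shows "\<rho> (idealizer_map h z x) = idealizer_map (\<rho> h) (\<rho> z) (\<rho> x)"
proof -
  have "\<rho> 2 = 2" using field_auts_simps(1,4)[OF assms] by (metis one_add_one)
  then show ?thesis
    by (simp add: idealizer_map_def field_auts_simps[OF assms] field_aut_QPJ[OF assms] idealizer_coeff_aut[OF assms] psi_map_aut[OF assms])
qed

text \<open>The sign of \<open>h\<close> affects only \<open>idealizer_coeff h\<close>; the change
  is matched by \<open>Q\<close>, which negates \<open>z - Q z\<close>.\<close>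

lemma idealizer_map_minus:
  assumes "odd t" "Q (Q z) = z"
  shows "idealizer_map (- h) z x = idealizer_map h (Q z) x"
proof -
  have "idealizer_coeff (- h) = - idealizer_coeff h" by (simp add: idealizer_coeff_def)
  then show ?thesis using assms by (simp add: idealizer_map_def algebra_simps diff_divide_distrib)
qed

section \<open>Scalings and roots for even \<open>t\<close>\<close>

text \<open>The hypotheses make \<open>a\<close> fixed by the fourth iterate of \<open>Q\<close>, so
  \<open>J a = Q (Q a)\<close>; then all four terms of \<open>psi_map (l * k) (a * x)\<close> carry
  the common factor \<open>Q a\<close>.\<close>

lemma psi_map_twist:
  assumes "a \<noteq> 0" "Q (Q a) * l = Q l * a" "l * Q (Q l) = 1" "t mod 4 = 2"
  shows "psi_map (l * k) (a * x) = Q a * psi_map k x"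
proof -
  have l0: "l \<noteq> 0" using assms(3) by auto
  have QQl: "Q (Q l) = 1 / l" using assms(3) l0 by (simp add: field_simps)
  have QQa: "Q (Q a) = Q l / l * a" using assms(2) l0 by (simp add: field_simps)
  have "Q (Q (Q (Q a))) = Q (Q (Q l)) / Q (Q l) * Q (Q a)" using QQa by simp
  also have "\<dots> = a" unfolding QQl QQa using l0 by simp
  finally have J: "J a = Q (Q a)" using J_cases(3) assms(4) by blast
  then have PJ: "P (J a) = Q a" by simp
  have "Q (J a) = Q (Q l) / Q l * Q a" unfolding J QQa by simp
  then have QJ: "l * Q l * Q (J a) = Q a" unfolding QQl using l0 by (simp add: field_simps)
  have "P (Q (Q a)) = l / P l * P a" unfolding QQa by simp
  then have Pa: "l / P l * P a = Q a" by simp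
  have "psi_map (l * k) (a * x) = Q a * Q x + P (J a) * P (J x)
      + k * Q k * (l * Q l * Q (J a)) * Q (J x) + k / P k * (l / P l * P a) * P x"
    by (simp add: psi_map_def mult_ac)
  then show ?thesis unfolding PJ QJ Pa by (simp add: psi_map_def algebra_simps)
qed

lemma norm_m1_power: "norm_m1 h \<longleftrightarrow> h ^ (q ^ t + 1) = -1"
  by (simp add: norm_m1_def J_def fr_def)

lemma Q_power: "Q x = x ^ q" "Q (Q x) = x ^ (q\<^sup>2)"
  by (simp_all add: Q_def fr_def power2_eq_square power_mult)

text \<open>For even \<open>t\<close> the number \<open>q ^ 2 - 1\<close> divides
  \<open>q ^ t - 1\<close>. So \<open>r\<close>, the quotient of \<open>q ^ (2 * t) - 1\<close> by
  \<open>q + 1\<close>, is an even multiple of \<open>q ^ t + 1\<close>, and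
  \<open>h ^ r = 1\<close>; hence \<open>h\<close> is a power with exponent
  \<open>q + 1\<close>.\<close>

lemma exists_q1_root:
  assumes h: "norm_m1 h" and ev: "even t"
  shows "\<exists>f. f * Q f = h"
proof -
  obtain j where j: "t = 2 * j" using ev by blast
  have "\<exists>S. q ^ (2 * j) = 1 + (q + 1) * ((q - 1) * S)"
  proof (induction j)
    case (Suc j)
    then obtain S where S: "q ^ (2 * j) = 1 + (q + 1) * ((q - 1) * S)" by blast
    obtain p where p: "q = Suc p" using q_gt_1 by (cases q) auto
    have "q ^ (2 * Suc j) = q ^ 2 * q ^ (2 * j)" by (simp add: power2_eq_square)
    also have "\<dots> = 1 + (q + 1) * ((q - 1) * (1 + q\<^sup>2 * S))"
      unfolding S by (simp add: p power2_eq_square algebra_simps)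
    finally show ?case by blast
  qed (intro exI[of _ 0], simp)
  then obtain S where S: "q ^ t = 1 + (q + 1) * ((q - 1) * S)" using j by blast
  have "q ^ t > 1" using q_gt_1 t by (intro one_less_power) auto
  then have pos: "(q - 1) * S > 0" using S by (metis add_0_right gr0I less_irrefl mult_0_right)
  define r where "r = (q ^ t + 1) * ((q - 1) * S)"
  have "q ^ (2 * t) = q ^ t * q ^ t" by (simp add: power_add mult_2)
  also have "\<dots> = 1 + (q + 1) * r"
  proof -
    define u where "u = (q - 1) * S"
    show ?thesis unfolding r_def S u_def[symmetric] by (simp add: algebra_simps)
  qed
  finally have "card (UNIV :: 'a set) - 1 = (q + 1) * r" by (simp add: card)
  moreover have "h ^ r = 1"
  proof -
    have "even ((q - 1) * S)" using q(2) by simp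
    have "h ^ r = (h ^ (q ^ t + 1)) ^ ((q - 1) * S)" by (simp only: r_def power_mult)
    also have "\<dots> = (-1) ^ ((q - 1) * S)" using h by (simp only: norm_m1_power)
    also have "\<dots> = 1" using \<open>even ((q - 1) * S)\<close> by (rule neg_one_even_power)
    finally show ?thesis .
  qed
  moreover have "r > 0" using pos by (simp add: r_def)
  ultimately obtain f where "f ^ (q + 1) = h"
    using exists_root_of_unit_power[of "q + 1" r h] by auto
  then show ?thesis by (auto simp: Q_power)
qed

section \<open>Equivalence of the codes as sets of maps\<close>

abbreviation iv :: "('a \<Rightarrow> 'a) \<Rightarrow> 'a \<Rightarrow> 'a" where "iv \<equiv> inv_into UNIV"

definition code_conj :: "('a \<Rightarrow> 'a) \<Rightarrow> ('a \<Rightarrow> 'a) \<Rightarrow> ('a \<Rightarrow> 'a) set \<Rightarrow> ('a \<Rightarrow> 'a) set" where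
  "code_conj u v C = (\<lambda>\<phi>. u \<circ> \<phi> \<circ> v) ` C"

lemma code_conj_code_conj: "code_conj u v (code_conj u' v' C) = code_conj (u \<circ> u') (v' \<circ> v) C"
  by (simp add: code_conj_def image_image comp_assoc)

lemma code_conj_id [simp]: "code_conj id id C = C"
  by (simp add: code_conj_def)

text \<open>\<open>\<tau>\<close> commutes with the Frobenius powers and so only changes the
  parameter to \<open>\<tau> h\<close>; the scalar \<open>a\<close> is absorbed since the
  coefficients in a code are arbitrary.\<close>

lemma code_conj_aut_code_maps:
  assumes a: "a \<noteq> 0" and \<tau>: "\<tau> \<in> field_auts"
  shows "code_conj (\<lambda>x. a * \<tau> x) (iv \<tau>) (code_maps h) = code_maps (\<tau> h)"
proof -
  note r = field_auts_simps[OF \<tau>]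
  have \<tau>inv: "\<tau> (iv \<tau> x) = x" for x by (simp add: surj_f_inv_f r)
  have eq: "(\<lambda>x. a * \<tau> x) \<circ> (\<lambda>x. c * x + d * psi_map h x) \<circ> iv \<tau>
      = (\<lambda>x. (a * \<tau> c) * x + (a * \<tau> d) * psi_map (\<tau> h) x)" for c d
    by (simp add: fun_eq_iff r psi_map_aut[OF \<tau>] \<tau>inv algebra_simps)
  show ?thesis
  proof
    show "code_conj (\<lambda>x. a * \<tau> x) (iv \<tau>) (code_maps h) \<subseteq> code_maps (\<tau> h)"
      by (auto simp: code_conj_def code_maps_def eq) (intro exI, rule refl)
    show "code_maps (\<tau> h) \<subseteq> code_conj (\<lambda>x. a * \<tau> x) (iv \<tau>) (code_maps h)"
    proof
      fix \<xi> assume "\<xi> \<in> code_maps (\<tau> h)"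
      then obtain c d where \<xi>: "\<xi> = (\<lambda>x. c * x + d * psi_map (\<tau> h) x)"
        by (auto simp: code_maps_def)
      have "\<xi> = (\<lambda>x. a * \<tau> x) \<circ> (\<lambda>x. iv \<tau> (c / a) * x + iv \<tau> (d / a) * psi_map h x) \<circ> iv \<tau>"
        unfolding eq using a by (simp add: \<tau>inv \<xi>)
      then show "\<xi> \<in> code_conj (\<lambda>x. a * \<tau> x) (iv \<tau>) (code_maps h)"
        by (auto simp: code_conj_def code_maps_def)
    qed
  qed
qed

lemma code_conj_aut_code_maps_right:
  assumes "a \<noteq> 0" "\<tau> \<in> field_auts"
  shows "code_conj (\<lambda>x. a * \<tau> x) (iv \<tau> \<circ> w) (code_maps h) = code_conj id w (code_maps (\<tau> h))"
  using code_conj_code_conj[of id w "\<lambda>x. a * \<tau> x" "iv \<tau>" "code_maps h"] by (simp add: code_conj_aut_code_maps[OF assms])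

lemma code_conj_scale:
  assumes "a \<noteq> 0" "c \<noteq> 0" and psi_map: "\<And>x. psi_map g (a * x) = c * psi_map k x"
  shows "code_conj id (\<lambda>x. a * x) (code_maps g) = code_maps k"
proof -
  have eq: "id \<circ> (\<lambda>x. d * x + e * psi_map g x) \<circ> (\<lambda>x. a * x) = (\<lambda>x. (d * a) * x + (e * c) * psi_map k x)" for d e
    by (simp add: fun_eq_iff psi_map mult.assoc)
  show ?thesis
  proof
    show "code_conj id (\<lambda>x. a * x) (code_maps g) \<subseteq> code_maps k"
      by (auto simp: code_conj_def code_maps_def eq simp del: id_comp) (intro exI, rule refl)
    show "code_maps k \<subseteq> code_conj id (\<lambda>x. a * x) (code_maps g)"
    proof
      fix \<xi> assume "\<xi> \<in> code_maps k"
      then obtain d e where \<xi>: "\<xi> = (\<lambda>x. d * x + e * psi_map k x)"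
        by (auto simp: code_maps_def)
      have "\<xi> = id \<circ> (\<lambda>x. (d / a) * x + (e / c) * psi_map g x) \<circ> (\<lambda>x. a * x)"
        unfolding eq using assms by (simp add: \<xi>)
      then show "\<xi> \<in> code_conj id (\<lambda>x. a * x) (code_maps g)"
        unfolding code_conj_def code_maps_def by blast
    qed
  qed
qed

text \<open>One inclusion is closure of the code under right composition with idealizer maps; the
  other uses the same closure for \<open>1 / z\<close>.\<close>

lemma code_conj_idealizer_map:
  assumes h: "norm_m1 h" and z: "Q (Q z) = z" "z \<noteq> 0"
  shows "code_conj id (idealizer_map h z) (code_maps h) = code_maps h"
proof -
  have sub: "code_conj id (idealizer_map h y) (code_maps h) \<subseteq> code_maps h" if y: "Q (Q y) = y" for y
  proof
    fix \<xi> assume "\<xi> \<in> code_conj id (idealizer_map h y) (code_maps h)"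
    then obtain c d where \<xi>: "\<xi> x = c * idealizer_map h y x + d * psi_map h (idealizer_map h y x)" for x
      by (auto simp: code_conj_def code_maps_def)
    obtain a b where ab: "idealizer_map h y x = a * x + b * psi_map h x" for x
      using idealizer_map_in_code_maps[of h y] by (auto simp: code_maps_iff)
    obtain a' b' where ab': "psi_map h (idealizer_map h y x) = a' * x + b' * psi_map h x" for x
      using psi_map_idealizer_map_in_code_maps[OF h y] by (auto simp: code_maps_iff)
    have "\<xi> x = (c * a + d * a') * x + (c * b + d * b') * psi_map h x" for x
      by (subst \<xi>, subst ab', subst ab) (simp add: algebra_simps)
    then show "\<xi> \<in> code_maps h" unfolding code_maps_iff by blast
  qed
  have "code_maps h = code_conj id (idealizer_map h (1 / z) \<circ> idealizer_map h z) (code_maps h)"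
    using idealizer_map_inverse[OF h z] by (simp add: comp_def flip: id_def)
  also have "\<dots> = code_conj id (idealizer_map h z) (code_conj id (idealizer_map h (1 / z)) (code_maps h))"
    by (simp add: code_conj_code_conj)
  also have "\<dots> \<subseteq> code_conj id (idealizer_map h z) (code_maps h)"
    unfolding code_conj_def[of id "idealizer_map h z"] by (intro image_mono sub) (use z in simp)
  finally show ?thesis using sub[OF z(1)] by blast
qed

text \<open>Since \<open>u \<circ> (c *) \<circ> u\<^sup>-\<^sup>1\<close> lies in the left idealizer of \<open>code_maps k\<close>, it is again a scalar
  multiplication; so \<open>u\<close> is multiplicative up to the factor \<open>u 1\<close>.\<close>

lemma code_conj_structure:
  assumes h: "norm_m1 h" and k: "norm_m1 k" and u: "bij u" "\<And>x y. u (x + y) = u x + u y"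
    and img: "code_conj u v (code_maps h) = code_maps k"
  obtains a \<tau> where "a \<noteq> 0" "\<tau> \<in> field_auts" "u = (\<lambda>x. a * \<tau> x)" "code_conj id (\<tau> \<circ> v) (code_maps (\<tau> h)) = code_maps k"
proof -
  have uinv: "iv u (u x) = x" "u (iv u x) = x" for x
    using u(1) by (auto simp: bij_def surj_f_inv_f)
  have "u 0 = 0" using u(2)[of 0 0] by (metis add.right_neutral add_left_cancel)
  then have u1: "u 1 \<noteq> 0" using uinv(1) by (metis zero_neq_one)
  have mult: "u (c * y) = u c * u y / u 1" for c y
  proof -
    have "\<exists>b. \<forall>x. (u \<circ> (\<lambda>x. c * x) \<circ> iv u) x = b * x"
    proof (rule code_maps_left_idealizer[OF k])
      fix \<xi> assume "\<xi> \<in> code_maps k"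
      then obtain d e where \<xi>: "\<xi> = u \<circ> (\<lambda>x. d * x + e * psi_map h x) \<circ> v"
        unfolding img[symmetric] by (auto simp: code_conj_def code_maps_def)
      have "(u \<circ> (\<lambda>x. c * x) \<circ> iv u) \<circ> \<xi> = u \<circ> (\<lambda>x. (c * d) * x + (c * e) * psi_map h x) \<circ> v"
        by (simp add: fun_eq_iff \<xi> uinv algebra_simps)
      then show "(u \<circ> (\<lambda>x. c * x) \<circ> iv u) \<circ> \<xi> \<in> code_maps k"
        unfolding img[symmetric] by (auto simp: code_conj_def code_maps_def)
    qed
    then obtain b where b: "u (c * iv u x) = b * x" for x by auto
    \<comment> \<open>Evaluating at \<open>u y\<close> and at \<open>u 1\<close> eliminates
      \<open>b\<close>.\<close>
    show ?thesis using b[of "u y"] b[of "u 1"] u1 by (simp add: uinv)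
  qed
  define \<tau> where "\<tau> x = u x / u 1" for x
  have u\<tau>: "u = (\<lambda>x. u 1 * \<tau> x)" using u1 by (simp add: \<tau>_def fun_eq_iff)
  have \<tau>: "\<tau> \<in> field_auts"
  proof (rule field_autsI)
    have "\<tau> = (\<lambda>x. x / u 1) \<circ> u" by (simp add: \<tau>_def fun_eq_iff)
    moreover have "bij (\<lambda>x. x / u 1)"
      by (rule o_bij[where g = "\<lambda>x. x * u 1"]) (use u1 in \<open>auto simp: fun_eq_iff\<close>)
    ultimately show "bij \<tau>" using u(1) bij_comp by metis
    show "\<tau> 1 = 1" using u1 by (simp add: \<tau>_def)
    show "\<tau> (x + y) = \<tau> x + \<tau> y" for x y by (simp add: \<tau>_def u(2) add_divide_distrib)
    show "\<tau> (x * y) = \<tau> x * \<tau> y" for x y using u1 by (simp add: \<tau>_def mult)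
  qed
  have "iv \<tau> \<circ> (\<tau> \<circ> v) = v"
    using field_auts_simps(10)[OF \<tau>] by (simp add: fun_eq_iff)
  then have "code_conj id (\<tau> \<circ> v) (code_maps (\<tau> h)) = code_maps k"
    using code_conj_aut_code_maps_right[OF u1 \<tau>, of "\<tau> \<circ> v" h] img u\<tau> by simp
  then show ?thesis using that[OF u1 \<tau> u\<tau>] by blast
qed

lemma code_conj_right_D:
  assumes "code_conj id w (code_maps g) = code_maps k"
  shows "w \<in> code_maps k" "psi_map g \<circ> w \<in> code_maps k" "\<exists>x. w x \<noteq> 0"
proof -
  have m: "\<xi> \<in> code_maps g \<Longrightarrow> \<xi> \<circ> w \<in> code_maps k" for \<xi>
    unfolding assms[symmetric] by (auto simp: code_conj_def)
  show "w \<in> code_maps k" "psi_map g \<circ> w \<in> code_maps k"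
    using m[OF id_in_code_maps] m[OF psi_map_in_code_maps] by auto
  \<comment> \<open>The identity lies in \<open>code_maps k\<close> and so factors through
    \<open>w\<close>; this rules out \<open>w 1 = 0\<close>.\<close>
  have "id \<in> code_conj id w (code_maps g)" using id_in_code_maps assms by simp
  then obtain c d where "\<forall>x. x = c * w x + d * psi_map g (w x)"
    by (auto simp: code_conj_def code_maps_def fun_eq_iff)
  from spec[OF this, of 1] show "\<exists>x. w x \<noteq> 0"
    by (intro exI[of _ 1]) (auto simp: psi_map_def)
qed

section \<open>Admissible quotients of the parameters\<close>

text \<open>These turn out to be the quotients \<open>\<tau> h / k\<close> for equivalent codes.
  \<open>l * Q (Q l)\<close> is \<open>l ^ (q ^ 2 + 1)\<close>.\<close>

definition twist :: "'a \<Rightarrow> bool" where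
  "twist l \<longleftrightarrow> (if t mod 4 = 2 then l * Q (Q l) = 1 else l = 1 \<or> l = -1)"

lemma twist_nz: "twist l \<Longrightarrow> l \<noteq> 0"
  by (auto simp: twist_def split: if_splits)

lemma twist_mult: "twist l \<Longrightarrow> twist m \<Longrightarrow> twist (l * m)"
proof (cases "t mod 4 = 2")
  case True
  assume "twist l" "twist m"
  then have "(l * Q (Q l)) * (m * Q (Q m)) = 1" using True by (simp add: twist_def)
  then show ?thesis using True by (simp add: twist_def mult_ac)
qed (auto simp: twist_def)

lemma twist_inverse: "twist l \<Longrightarrow> twist (1 / l)"
  by (auto simp: twist_def mult.commute split: if_splits)

lemma twist_aut: "\<rho> \<in> field_auts \<Longrightarrow> twist l \<Longrightarrow> twist (\<rho> l)"
proof -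
  assume \<rho>: "\<rho> \<in> field_auts" and l: "twist l"
  have "\<rho> (l * Q (Q l)) = \<rho> l * Q (Q (\<rho> l))"
    by (simp add: field_auts_simps[OF \<rho>] field_aut_QPJ[OF \<rho>])
  then show ?thesis using l field_auts_simps(4,5)[OF \<rho>] by (auto simp: twist_def split: if_splits)
qed

lemma code_conj_twist_D:
  assumes g: "norm_m1 g" and k: "norm_m1 k" and w: "code_conj id w (code_maps g) = code_maps k"
  shows "twist (g / k)"
proof -
  have nz: "g \<noteq> 0" "k \<noteq> 0" using norm_m1D g k by auto
  obtain x where "w x \<noteq> 0" using code_conj_right_D(3)[OF w] by blast
  then have "g * Q (Q g) = k * Q (Q k)"
    using code_maps_right_Q2[OF g k code_conj_right_D(1,2)[OF w]] by blast
  then have 1: "(g / k) * Q (Q (g / k)) = 1" using nz by (simp add: field_simps)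
  \<comment> \<open>The norms \<open>-1\<close> of \<open>g\<close> and \<open>k\<close> cancel in
    the quotient.\<close>
  have 2: "(g / k) * J (g / k) = 1"
    using g k by (simp add: norm_m1_def)
  show ?thesis
    using 1 square_eq_1_of_norms[OF 1 2] by (auto simp: twist_def power2_eq_1_iff)
qed

text \<open>If \<open>t mod 4 = 2\<close>, this is \<open>psi_map_twist\<close> with
  \<open>l = g / k\<close>. Otherwise \<open>g\<close> is \<open>k\<close> or \<open>- k\<close>,
  and \<open>psi_map\<close> is insensitive to the sign.\<close>

lemma code_conj_twist_I:
  assumes l: "twist (g / k)" and k: "norm_m1 k"
    and a: "a \<noteq> 0" "if t mod 4 = 2 then Q (Q a) * (g / k) = Q (g / k) * a else a = 1"
  shows "code_conj id (\<lambda>x. a * x) (code_maps g) = code_maps k"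
proof (cases "t mod 4 = 2")
  case True
  have k0: "k \<noteq> 0" using norm_m1D[OF k] by simp
  then have g: "g / k * k = g" by simp
  show ?thesis
    by (rule code_conj_scale[of a "Q a"])
      (use psi_map_twist[of a "g / k" k, unfolded g] l a True in \<open>auto simp: twist_def\<close>)
next
  case False
  have k0: "k \<noteq> 0" using norm_m1D[OF k] by simp
  then have "g = k \<or> g = - k" using l False by (auto simp: twist_def field_simps)
  then have "psi_map g = psi_map k" by (auto simp: fun_eq_iff)
  then show ?thesis by (intro code_conj_scale[of a 1]) (use a False in auto)
qed

lemma exists_scale_twist:
  assumes l: "twist l"
  shows "\<exists>a. a \<noteq> 0 \<and> (if t mod 4 = 2 then Q (Q a) * l = Q l * a else a = 1)"
proof (cases "t mod 4 = 2")
  case True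
  have l1: "l * Q (Q l) = 1" and l0: "l \<noteq> 0" using l twist_nz[OF l] True by (auto simp: twist_def)
  have QQl: "Q (Q l) = 1 / l" using l1 l0 by (simp add: field_simps)
  \<comment> \<open>A sum in the manner of Hilbert 90: \<open>Q \<circ> Q\<close> inverts
    \<open>l / Q l\<close>, so it takes \<open>a\<close> to \<open>1 + Q l / l\<close>, which is
    \<open>Q l / l\<close> times \<open>a\<close>.\<close>
  define a where "a = 1 + l / Q l"
  have "Q (Q a) * l = Q l * a"
  proof -
    have "Q (Q a) = 1 + Q (Q l) / Q (Q (Q l))" by (simp add: a_def)
    also have "\<dots> = 1 + Q l / l" unfolding QQl using l0 by simp
    finally show ?thesis using l0 by (simp add: a_def field_simps)
  qed
  moreover have "a \<noteq> 0"
  proof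
    \<comment> \<open>Then \<open>Q l = - l\<close>, so \<open>Q (Q l) = l\<close> and
      \<open>l ^ 2 = 1\<close>; but square roots of \<open>1\<close> are fixed by
      \<open>Q\<close>.\<close>
    assume "a = 0"
    then have "Q l = - l" using l0 by (simp add: a_def field_simps add_eq_0_iff)
    then have "l\<^sup>2 = 1" using l1 by (simp add: power2_eq_square)
    then have "Q l = l" by (rule square_eq_1D)
    then show False using \<open>Q l = - l\<close> l0 eq_minus_self_iff by metis
  qed
  ultimately show ?thesis using True by auto
qed (auto intro: exI[of _ 1])

section \<open>Maps induced by \<open>q\<close>-polynomials\<close>

definition lin_maps :: "('a \<Rightarrow> 'a) set" where "lin_maps = range lin"

lemma lin_maps_add: "f \<in> lin_maps \<Longrightarrow> g \<in> lin_maps \<Longrightarrow> (\<lambda>x. f x + g x) \<in> lin_maps"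
proof -
  assume "f \<in> lin_maps" "g \<in> lin_maps"
  then obtain c d where "f = lin c" "g = lin d" by (auto simp: lin_maps_def)
  then have "(\<lambda>x. f x + g x) = lin (\<lambda>i. c i + d i)"
    by (simp add: lin_def fun_eq_iff sum.distrib algebra_simps)
  then show ?thesis by (simp add: lin_maps_def)
qed

lemma lin_maps_mult: "f \<in> lin_maps \<Longrightarrow> (\<lambda>x. a * f x) \<in> lin_maps"
proof -
  assume "f \<in> lin_maps"
  then obtain c where "f = lin c" by (auto simp: lin_maps_def)
  then have "(\<lambda>x. a * f x) = lin (\<lambda>i. a * c i)"
    by (simp add: lin_def fun_eq_iff sum_distrib_left mult_ac)
  then show ?thesis by (simp add: lin_maps_def)
qed

lemma lin_maps_fr: "fr j \<in> lin_maps"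
proof -
  have "lin (\<lambda>i. if i = j mod (2*t) then 1 else 0) x = fr j x" for x
  proof -
    have "lin (\<lambda>i. if i = j mod (2*t) then 1 else 0) x
        = (\<Sum>i<2*t. if i = j mod (2*t) then fr i x else 0)"
      unfolding lin_def by (rule sum.cong) auto
    also have "\<dots> = fr j x" using t by (simp add: fr_mod)
    finally show ?thesis .
  qed
  then show ?thesis unfolding lin_maps_def by (metis ext rangeI)
qed

lemma lin_maps_sum:
  assumes "\<And>i. i \<in> A \<Longrightarrow> f i \<in> lin_maps"
  shows "(\<lambda>x. \<Sum>i\<in>A. f i x) \<in> lin_maps"
proof -
  have "(\<lambda>x. 0) \<in> lin_maps" using lin_maps_mult[OF lin_maps_fr, of 0] by simp
  then show ?thesis using assms
    by (induction A rule: infinite_finite_induct) (auto intro!: lin_maps_add)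
qed

lemma lin_maps_comp:
  assumes "f \<in> lin_maps" "g \<in> lin_maps"
  shows "f \<circ> g \<in> lin_maps"
proof -
  obtain c d where cd: "f = lin c" "g = lin d" using assms by (auto simp: lin_maps_def)
  have sum: "fr i (\<Sum>j\<in>A. y j) = (\<Sum>j\<in>A. fr i (y j))" for i A and y :: "nat \<Rightarrow> 'a"
    by (induction A rule: infinite_finite_induct) (auto simp: field_auts_simps[OF fr_aut])
  have "f \<circ> g = (\<lambda>x. \<Sum>i<2*t. c i * (\<Sum>j<2*t. fr i (d j) * fr (i + j) x))"
    by (simp add: fun_eq_iff cd lin_def sum field_auts_simps[OF fr_aut] fr_fr)
  also have "\<dots> \<in> lin_maps" by (intro lin_maps_sum lin_maps_mult lin_maps_fr)
  finally show ?thesis .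
qed

lemma lin_maps_scale: "(\<lambda>x. a * x) \<in> lin_maps"
  using lin_maps_mult[OF lin_maps_fr[of 0], of a] by simp

lemma lin_maps_id: "(\<lambda>x. x) \<in> lin_maps"
  using lin_maps_scale[of 1] by simp

lemma lin_maps_code_maps: "code_maps h \<subseteq> lin_maps"
proof
  fix \<xi> assume "\<xi> \<in> code_maps h"
  then obtain a b where \<xi>: "\<xi> = (\<lambda>x. a * x + b * psi_map h x)"
    by (auto simp: code_maps_def)
  show "\<xi> \<in> lin_maps"
    unfolding \<xi> psi_map_def QPJ_words(7,8) unfolding QPJ_words(2,3)
    by (intro lin_maps_add lin_maps_mult lin_maps_fr lin_maps_id)
qed

lemma lin_maps_additive: "f \<in> lin_maps \<Longrightarrow> f (x + y) = f x + f y"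
  by (auto simp: lin_maps_def lin_def field_auts_simps[OF fr_aut] sum.distrib algebra_simps)

text \<open>Since \<open>\<rho>\<close> commutes with Frobenius powers, conjugation by it only
  applies \<open>\<rho>\<close> to the coefficients.\<close>

lemma lin_maps_conj:
  assumes "\<rho> \<in> field_auts" "f \<in> lin_maps"
  shows "\<rho> \<circ> f \<circ> iv \<rho> \<in> lin_maps"
proof -
  obtain c where c: "f = lin c" using assms(2) by (auto simp: lin_maps_def)
  note r = field_auts_simps[OF assms(1)]
  have sum: "\<rho> (\<Sum>j\<in>A. y j) = (\<Sum>j\<in>A. \<rho> (y j))" for A and y :: "nat \<Rightarrow> 'a"
    by (induction A rule: infinite_finite_induct) (auto simp: r)
  have "\<rho> \<circ> f \<circ> iv \<rho> = lin (\<lambda>i. \<rho> (c i))"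
    by (simp add: c lin_def fun_eq_iff sum r field_aut_fr[OF assms(1)] surj_f_inv_f)
  then show ?thesis by (simp add: lin_maps_def)
qed

definition lin_units :: "('a \<Rightarrow> 'a) set" where
  "lin_units = {f \<in> lin_maps. \<exists>g \<in> lin_maps. f \<circ> g = id \<and> g \<circ> f = id}"

lemma lin_units_D: "f \<in> lin_units \<Longrightarrow> f \<in> lin_maps" "f \<in> lin_units \<Longrightarrow> bij f" "f \<in> lin_units \<Longrightarrow> iv f \<in> lin_units"
proof -
  assume f: "f \<in> lin_units"
  then obtain g where g: "f \<in> lin_maps" "g \<in> lin_maps" "f \<circ> g = id" "g \<circ> f = id"
    by (auto simp: lin_units_def)
  show "f \<in> lin_maps" "bij f" using g o_bij by auto
  have "iv f = g" using g inv_unique_comp by blast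
  then show "iv f \<in> lin_units" using g by (auto simp: lin_units_def)
qed

lemma lin_units_I: "f \<in> lin_maps \<Longrightarrow> g \<in> lin_maps \<Longrightarrow> (\<And>x. f (g x) = x) \<Longrightarrow> (\<And>x. g (f x) = x) \<Longrightarrow> f \<in> lin_units"
  unfolding lin_units_def by (auto simp: fun_eq_iff intro!: bexI[of _ g])

lemma lin_units_comp: "f \<in> lin_units \<Longrightarrow> g \<in> lin_units \<Longrightarrow> f \<circ> g \<in> lin_units"
  by (rule lin_units_I[of _ "iv g \<circ> iv f"])
    (auto intro: lin_maps_comp lin_units_D simp: surj_f_inv_f bij_is_surj bij_is_inj lin_units_D(2))

lemma lin_units_conj: "\<rho> \<in> field_auts \<Longrightarrow> f \<in> lin_units \<Longrightarrow> \<rho> \<circ> f \<circ> iv \<rho> \<in> lin_units"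
  by (rule lin_units_I[of _ "\<rho> \<circ> iv f \<circ> iv \<rho>"])
    (auto intro: lin_maps_conj lin_units_D simp: surj_f_inv_f bij_is_surj bij_is_inj lin_units_D(2) field_auts_simps)

lemma lin_units_scale: "a \<noteq> 0 \<Longrightarrow> (\<lambda>x. a * x) \<in> lin_units"
  by (rule lin_units_I[OF lin_maps_scale lin_maps_scale[of "1 / a"]]) auto

lemma lin_units_idealizer_map:
  assumes "norm_m1 h" "Q (Q z) = z" "z \<noteq> 0"
  shows "idealizer_map h z \<in> lin_units"
  by (rule lin_units_I[OF subsetD[OF lin_maps_code_maps idealizer_map_in_code_maps] subsetD[OF lin_maps_code_maps idealizer_map_in_code_maps[of h "1 / z"]]])
    (rule idealizer_map_inverse[OF assms])+

section \<open>From maps to reduced polynomials\<close>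

text \<open>The modulus vanishes at every element of the field, so reduction does not change
  values.\<close>

lemma poly_q_comp: "poly (q_comp q (2 * t) f g) x = poly f (poly g (x :: 'a))"
proof -
  let ?m = "monom 1 (q ^ (2 * t)) - monom 1 1 :: 'a poly"
  have "poly ?m x = 0" using power_card_UNIV_eq[of x] by (simp add: poly_monom card)
  moreover have "poly (pcompose f g) x = poly (pcompose f g div ?m * ?m + pcompose f g mod ?m) x"
    by (simp only: div_mult_mod_eq)
  ultimately show ?thesis unfolding q_comp_def by (simp add: poly_pcompose del: div_mult_mod_eq)
qed

lemma degree_q_comp: "degree (q_comp q (2 * t) f (g :: 'a poly)) < q ^ (2 * t)"
proof -
  let ?m = "monom 1 (q ^ (2 * t)) - monom 1 1 :: 'a poly"
  have gt: "q ^ (2 * t) > 1" using q_gt_1 t by (intro one_less_power) auto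
  have "?m = monom 1 (q ^ (2 * t)) + (- monom 1 1)" by simp
  then have deg: "degree ?m = q ^ (2 * t)"
    using gt by (simp only:) (subst degree_add_eq_left, auto simp: degree_monom_eq)
  then have "?m \<noteq> 0" using gt by (metis degree_0 less_nat_zero_code)
  show ?thesis
  proof (cases "?m dvd pcompose f g")
    case True
    then show ?thesis using q_gt_1 by (simp add: q_comp_def dvd_imp_mod_0)
  next
    case False
    show ?thesis using degree_mod_less_degree[OF \<open>?m \<noteq> 0\<close> False]
      by (simp only: q_comp_def deg)
  qed
qed

text \<open>Below degree \<open>q ^ (2 * t)\<close> a polynomial is determined by its values, so
  membership can be tested on the induced map.\<close>

lemma q_polys_iff: "p \<in> q_polys q (2 * t) \<longleftrightarrow> degree p < q ^ (2 * t) \<and> poly p \<in> lin_maps"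
proof
  assume "p \<in> q_polys q (2 * t)"
  then obtain c where "p = (\<Sum>i<2*t. monom (c i) (q ^ i))" by (auto simp: q_polys_def)
  moreover have "poly (\<Sum>i<2*t. monom (c i) (q ^ i)) = lin c" by (simp add: fun_eq_iff poly_lin)
  ultimately show "degree p < q ^ (2 * t) \<and> poly p \<in> lin_maps"
    using degree_q_poly by (simp add: lin_maps_def)
next
  assume p: "degree p < q ^ (2 * t) \<and> poly p \<in> lin_maps"
  then obtain c where "poly p = lin c" by (auto simp: lin_maps_def)
  then have "p = (\<Sum>i<2*t. monom (c i) (q ^ i))"
    by (intro poly_eqI_UNIV) (use p degree_q_poly in \<open>auto simp: poly_lin\<close>)
  then show "p \<in> q_polys q (2 * t)" by (auto simp: q_polys_def)
qed

lemma poly_monom_1: "poly (monom a (Suc 0)) = (\<lambda>x. a * x :: 'a)" "poly (monom 1 (Suc 0)) = (id :: 'a \<Rightarrow> 'a)"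
  by (auto simp: poly_monom fun_eq_iff)

lemma degree_monom_1: "degree (monom a (Suc 0)) < q ^ (2 * t)"
proof -
  have "q ^ (2 * t) > 1" using q_gt_1 t by (intro one_less_power) auto
  then show ?thesis using degree_monom_le[of a "Suc 0"] by simp
qed

lemma q_comp_eq_monom_iff:
  "q_comp q (2 * t) f g = monom 1 1 \<longleftrightarrow> poly f \<circ> poly g = (id :: 'a \<Rightarrow> 'a)"
proof
  assume "q_comp q (2 * t) f g = monom 1 1"
  then have "poly (q_comp q (2 * t) f g) x = x" for x by (simp add: poly_monom)
  then show "poly f \<circ> poly g = id" by (simp add: fun_eq_iff poly_q_comp)
next
  assume "poly f \<circ> poly g = id"
  then show "q_comp q (2 * t) f g = monom 1 1"
    by (intro poly_eqI_UNIV) (use degree_q_comp degree_monom_1 in \<open>auto simp: poly_q_comp poly_monom fun_eq_iff\<close>)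
qed

lemma q_polys_poly_surj:
  assumes "f \<in> lin_maps" shows "\<exists>p \<in> q_polys q (2 * t). poly p = f"
proof -
  obtain c where c: "f = lin c" using assms by (auto simp: lin_maps_def)
  then have "poly (\<Sum>i<2*t. monom (c i) (q ^ i)) = f" by (simp add: fun_eq_iff poly_lin)
  then show ?thesis by (auto simp: q_polys_def)
qed

lemma inv_q_polys_iff: "p \<in> inv_q_polys q (2 * t) \<longleftrightarrow> degree p < q ^ (2 * t) \<and> poly p \<in> lin_units"
proof -
  have "p \<in> inv_q_polys q (2 * t) \<longleftrightarrow> p \<in> q_polys q (2 * t) \<and>
      (\<exists>M \<in> q_polys q (2 * t). poly p \<circ> poly M = id \<and> poly M \<circ> poly p = id)"
    by (simp add: inv_q_polys_def q_comp_eq_monom_iff del: One_nat_def)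
  also have "(\<exists>M \<in> q_polys q (2 * t). poly p \<circ> poly M = id \<and> poly M \<circ> poly p = id) \<longleftrightarrow>
      (\<exists>g \<in> lin_maps. poly p \<circ> g = id \<and> g \<circ> poly p = id)"
    using q_polys_poly_surj q_polys_iff by metis
  finally show ?thesis by (auto simp: lin_units_def q_polys_iff)
qed

lemma monom_in_inv_q_polys: "(a :: 'a) \<noteq> 0 \<Longrightarrow> monom a (Suc 0) \<in> inv_q_polys q (2 * t)"
  unfolding inv_q_polys_iff poly_monom_1(1) by (simp add: degree_monom_1 lin_units_scale)

lemma inv_q_polys_obtain:
  assumes "f \<in> lin_units" obtains p where "p \<in> inv_q_polys q (2 * t)" "poly p = f"
  using q_polys_poly_surj[of f] lin_units_D(1)[OF assms] assms by (auto simp: inv_q_polys_iff q_polys_iff)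

lemma poly_map_poly_aut:
  assumes "\<rho> \<in> field_auts"
  shows "poly (map_poly \<rho> p) = \<rho> \<circ> poly p \<circ> iv \<rho>"
  using poly_map_poly_field_aut[OF assms, of p "iv \<rho> x" for x] field_auts_simps(11)[OF assms]
  by (simp add: fun_eq_iff surj_f_inv_f)

lemma inj_poly_degree: "inj_on poly {p :: 'a poly. degree p < q ^ (2 * t)}"
  by (rule inj_onI) (auto intro: poly_eqI_UNIV)

text \<open>This moves equations of codes from polynomials to maps: \<open>poly\<close> is injective
  in low degree, and \<open>map_poly \<rho> \<phi>\<close> induces the conjugate of
  \<open>\<phi>\<close> by \<open>\<rho>\<close>, whose two outer factors are absorbed by
  \<open>L1\<close> and \<open>L2\<close>.\<close>

lemma code_image_iff:
  fixes C C' :: "'a poly set"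
  assumes \<rho>: "\<rho> \<in> field_auts" and C': "C' \<subseteq> {p. degree p < q ^ (2 * t)}"
  shows "code_image q (2 * t) L1 L2 \<rho> C = C' \<longleftrightarrow>
    code_conj (poly L1 \<circ> \<rho>) (iv \<rho> \<circ> poly L2) (poly ` C) = poly ` C'"
proof -
  have eq: "poly ` code_image q (2 * t) L1 L2 \<rho> C = code_conj (poly L1 \<circ> \<rho>) (iv \<rho> \<circ> poly L2) (poly ` C)"
    unfolding code_image_def code_conj_def image_image
    by (rule image_cong[OF refl]) (simp add: fun_eq_iff poly_q_comp poly_map_poly_aut[OF \<rho>])
  have "code_image q (2 * t) L1 L2 \<rho> C \<subseteq> {p. degree p < q ^ (2 * t)}"
    using degree_q_comp by (auto simp: code_image_def)
  then show ?thesis unfolding eq[symmetric] using C' inj_on_image_eq_iff[OF inj_poly_degree] by blast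
qed

lemma poly_psi:
  assumes h: "norm_m1 h"
  shows "poly (psi q t h) = psi_map h"
proof
  fix x
  have h0: "h \<noteq> 0" and Jh: "J h = - 1 / h" using norm_m1D[OF h] by auto
  have pow: "h powi (1 - int q ^ j) = h / fr j h" for j
    using h0 by (simp add: power_int_diff fr_def flip: of_nat_power)
  \<comment> \<open>By \<open>J h = - 1 / h\<close>, the power of \<open>h\<close> at
    \<open>q ^ (t + 1)\<close> becomes \<open>- h * Q h\<close>; with the minus sign in
    \<open>psi\<close> this gives the third term of \<open>psi_map\<close>.\<close>
  have JQ: "fr (t + 1) h = - 1 / Q h" using Jh by (simp add: QPJ_words(7)[symmetric] del: One_nat_def)
  have e: "x ^ q = Q x" "x ^ q ^ (t - 1) = P (J x)" "x ^ q ^ (t + 1) = Q (J x)" "x ^ q ^ (2 * t - 1) = P x"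
    unfolding QPJ_words(7,8) unfolding QPJ_words(2,3) by (simp_all add: fr_def)
  have "fr (2 * t - 1) h = P h" by (simp add: P_def)
  then show "poly (psi q t h) x = psi_map h x"
    unfolding psi_def poly_add poly_diff poly_monom pow e JQ using h0 by (simp add: psi_map_def)
qed

lemma poly_code: "norm_m1 h \<Longrightarrow> poly ` code q t h = code_maps h"
proof -
  assume "norm_m1 h"
  then have "poly (smult a (monom 1 1) + smult b (psi q t h)) = (\<lambda>x. a * x + b * psi_map h x)" for a b
    by (simp add: fun_eq_iff poly_psi poly_monom)
  note this[symmetric]
  then show ?thesis unfolding code_def code_maps_def by (simp only:) blast
qed

lemma degree_code: "code q t h \<subseteq> {p :: 'a poly. degree p < q ^ (2 * t)}"
proof -
  have lt: "q ^ i < q ^ (2 * t)" if "i < 2 * t" for i using that q_gt_1 by simp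
  have mon: "degree (monom c (q ^ i)) < q ^ (2 * t)" if "i < 2 * t" for i and c :: 'a
    using lt[OF that] degree_monom_le[of c "q ^ i"] by simp
  have "degree (psi q t h) < q ^ (2 * t)"
    unfolding psi_def using mon[of 1] mon[of "t - 1"] mon[of "t + 1"] mon[of "2 * t - 1"] t
    by (intro degree_add_less degree_diff_less) auto
  moreover have "degree (smult a p) < q ^ (2 * t)" if "degree p < q ^ (2 * t)" for a and p :: "'a poly"
    using that degree_smult_le le_less_trans by blast
  ultimately show ?thesis
    using degree_monom_1[of 1] unfolding code_def One_nat_def
    by (auto intro!: degree_add_less simp del: degree_smult_eq)
qed

lemma code_image_code_iff:
  assumes "norm_m1 h" "norm_m1 k" "\<rho> \<in> field_auts"
  shows "code_image q (2 * t) L1 L2 \<rho> (code q t h) = code q t k \<longleftrightarrow>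
    code_conj (poly L1 \<circ> \<rho>) (iv \<rho> \<circ> poly L2) (code_maps h) = code_maps k"
  using code_image_iff[OF assms(3) degree_code, of L1 L2 "code q t h" k] by (simp add: poly_code assms)

lemma semilinear_bij_additive:
  assumes "f \<in> lin_units" "\<rho> \<in> field_auts"
  shows "bij (f \<circ> \<rho>)" "(f \<circ> \<rho>) (x + y) = (f \<circ> \<rho>) x + (f \<circ> \<rho>) y"
  using lin_units_D[OF assms(1)] field_auts_simps[OF assms(2)] lin_maps_additive by (auto simp: bij_comp)

theorem equiv_codes_iff_twist:
  assumes h: "norm_m1 h" and k: "norm_m1 k"
  shows "equiv_codes q (2 * t) (code q t h) (code q t k) \<longleftrightarrow> (\<exists>\<tau> \<in> field_auts. twist (\<tau> h / k))"
proof
  assume "equiv_codes q (2 * t) (code q t h) (code q t k)"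
  then obtain L1 L2 \<rho> where L: "L1 \<in> inv_q_polys q (2 * t)" and \<rho>: "\<rho> \<in> field_auts"
    and eq: "code q t k = code_image q (2 * t) L1 L2 \<rho> (code q t h)"
    unfolding equiv_codes_def by blast
  have img: "code_conj (poly L1 \<circ> \<rho>) (iv \<rho> \<circ> poly L2) (code_maps h) = code_maps k"
    using eq code_image_code_iff[OF h k \<rho>] by metis
  have lin_units: "poly L1 \<in> lin_units" using L by (simp add: inv_q_polys_iff)
  obtain a \<tau> where \<tau>: "\<tau> \<in> field_auts" "code_conj id (\<tau> \<circ> (iv \<rho> \<circ> poly L2)) (code_maps (\<tau> h)) = code_maps k"
    using code_conj_structure[OF h k semilinear_bij_additive[OF lin_units \<rho>] img] by metis
  then show "\<exists>\<tau> \<in> field_auts. twist (\<tau> h / k)"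
    using code_conj_twist_D[OF norm_m1_aut[OF \<tau>(1) h] k \<tau>(2)] by blast
next
  assume "\<exists>\<tau> \<in> field_auts. twist (\<tau> h / k)"
  then obtain \<tau> where \<tau>: "\<tau> \<in> field_auts" "twist (\<tau> h / k)" by blast
  \<comment> \<open>The triple will be \<open>(x, a x, \<tau>)\<close>, with \<open>a\<close>
    adjusting \<open>code_maps (\<tau> h)\<close> to \<open>code_maps k\<close>.\<close>
  obtain a where a: "a \<noteq> 0" "code_conj id (\<lambda>x. a * x) (code_maps (\<tau> h)) = code_maps k"
    using exists_scale_twist[OF \<tau>(2)] code_conj_twist_I[OF \<tau>(2) k] by metis
  have "code_conj \<tau> (iv \<tau> \<circ> (\<lambda>x. a * x)) (code_maps h) = code_maps k"
    using code_conj_aut_code_maps_right[of 1 \<tau> "\<lambda>x. a * x" h] \<tau> a by simp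
  moreover have "poly (monom 1 1) \<circ> \<tau> = \<tau>" by (simp add: fun_eq_iff poly_monom)
  ultimately have "code_image q (2 * t) (monom 1 1) (monom a 1) \<tau> (code q t h) = code q t k"
    using code_image_code_iff[OF h k \<tau>(1)] by (simp add: poly_monom_1)
  moreover have "monom (1 :: 'a) 1 \<in> inv_q_polys q (2 * t)" "monom a 1 \<in> inv_q_polys q (2 * t)"
    using a(1) by (simp_all add: monom_in_inv_q_polys)
  ultimately show "equiv_codes q (2 * t) (code q t h) (code q t k)"
    unfolding equiv_codes_def using \<tau>(1) by metis
qed

end

section \<open>The automorphism group\<close>

lemma group_semidirect:
  assumes N: "group N" and H: "group H" and \<theta>: "\<theta> \<in> hom H (AutoGroup N)"
  shows "group (semidirect N H \<theta>)"
proof -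
  interpret N: group N by (rule N)
  interpret H: group H by (rule H)
  have auto: "\<theta> g \<in> auto N" if "g \<in> carrier H" for g
    using \<theta> that by (auto simp: hom_def AutoGroup_def)
  have closed: "\<theta> g x \<in> carrier N" if "g \<in> carrier H" "x \<in> carrier N" for g x
    using auto[OF that(1)] that(2) by (auto simp: auto_def hom_def)
  have mult: "\<theta> g (x \<otimes>\<^bsub>N\<^esub> y) = \<theta> g x \<otimes>\<^bsub>N\<^esub> \<theta> g y"
    if "g \<in> carrier H" "x \<in> carrier N" "y \<in> carrier N" for g x y
    using auto[OF that(1)] that(2,3) by (auto simp: auto_def hom_def)
  have comp: "\<theta> (g \<otimes>\<^bsub>H\<^esub> k) x = \<theta> g (\<theta> k x)"
    if "g \<in> carrier H" "k \<in> carrier H" "x \<in> carrier N" for g k x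
  proof -
    have "\<theta> (g \<otimes>\<^bsub>H\<^esub> k) = \<theta> g \<otimes>\<^bsub>AutoGroup N\<^esub> \<theta> k"
      using \<theta> that by (auto simp: hom_def)
    also have "\<dots> = compose (carrier N) (\<theta> g) (\<theta> k)"
      using auto[OF that(1)] auto[OF that(2)] by (simp add: AutoGroup_def BijGroup_def auto_def)
    finally show ?thesis using that(3) by (simp add: compose_def)
  qed
  \<comment> \<open>\<open>\<theta>\<close> of the identity is idempotent by \<open>comp\<close> and
    also injective, so it fixes \<open>carrier N\<close> pointwise.\<close>
  have one: "\<theta> \<one>\<^bsub>H\<^esub> x = x" if x: "x \<in> carrier N" for x
  proof -
    have inj: "inj_on (\<theta> \<one>\<^bsub>H\<^esub>) (carrier N)"
      using auto[OF H.one_closed] by (auto simp: auto_def Bij_def bij_betw_def)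
    have "\<theta> \<one>\<^bsub>H\<^esub> (\<theta> \<one>\<^bsub>H\<^esub> x) = \<theta> \<one>\<^bsub>H\<^esub> x" using comp[of "\<one>\<^bsub>H\<^esub>" "\<one>\<^bsub>H\<^esub>" x] x
      by simp
    then show ?thesis using inj x closed by (auto dest: inj_onD)
  qed
  show ?thesis
  proof (rule groupI)
    fix x y z
    assume "x \<in> carrier (semidirect N H \<theta>)" "y \<in> carrier (semidirect N H \<theta>)" "z \<in> carrier (semidirect N H \<theta>)"
    then show "x \<otimes>\<^bsub>semidirect N H \<theta>\<^esub> y \<otimes>\<^bsub>semidirect N H \<theta>\<^esub> z =
        x \<otimes>\<^bsub>semidirect N H \<theta>\<^esub> (y \<otimes>\<^bsub>semidirect N H \<theta>\<^esub> z)"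
      by (auto simp: semidirect_def closed mult comp N.m_assoc H.m_assoc)
  next
    fix x assume "x \<in> carrier (semidirect N H \<theta>)"
    then obtain a g where x: "x = (a, g)" "a \<in> carrier N" "g \<in> carrier H"
      by (auto simp: semidirect_def)
    then show "\<exists>y \<in> carrier (semidirect N H \<theta>). y \<otimes>\<^bsub>semidirect N H \<theta>\<^esub> x = \<one>\<^bsub>semidirect N H \<theta>\<^esub>"
      by (intro bexI[of _ "(m_inv N (\<theta> (m_inv H g) a), m_inv H g)"]) (auto simp: semidirect_def closed)
  qed (auto simp: semidirect_def closed one)
qed

lemma group_subfield_units: "group (subfield_units q m :: 'a::{field,finite} monoid)"
proof (rule groupI)
  fix x :: 'a assume "x \<in> carrier (subfield_units q m)"
  then show "\<exists>y \<in> carrier (subfield_units q m). y \<otimes>\<^bsub>subfield_units q m\<^esub> x = \<one>\<^bsub>subfield_units q m\<^esub>"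
    by (intro bexI[of _ "inverse x"]) (auto simp: subfield_units_def power_inverse)
qed (auto simp: subfield_units_def power_mult_distrib)

text \<open>The element \<open>f\<close> provides the splitting: \<open>\<rho> \<mapsto> \<rho> f / f\<close> is a cocycle, and scaling by it
  carries \<open>code_maps (\<rho> h)\<close> to \<open>code_maps h\<close>.\<close>

locale twisted_code = even_degree_field q t T
  for q t and T :: "'a::{field,finite} itself" +
  fixes h f :: 'a
  assumes h: "norm_m1 h" and f0: "f \<noteq> 0"
    and f: "t mod 4 = 2 \<Longrightarrow> f * Q f = h" "t mod 4 \<noteq> 2 \<Longrightarrow> f = 1"
begin

lemma h0: "h \<noteq> 0"
  using norm_m1D[OF h] by simp

section \<open>The group of triples stabilizing a code\<close>

abbreviation A where "A \<equiv> aut_triples q (2 * t) (code q t h)"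

definition pair :: "'a poly \<times> 'a poly \<times> ('a \<Rightarrow> 'a) \<Rightarrow> ('a \<Rightarrow> 'a) \<times> ('a \<Rightarrow> 'a)" where
  "pair = (\<lambda>(L1, L2, \<rho>). (poly L1 \<circ> \<rho>, iv \<rho> \<circ> poly L2))"

lemma carrier_A: "(L1, L2, \<rho>) \<in> carrier A \<longleftrightarrow>
    L1 \<in> inv_q_polys q (2 * t) \<and> L2 \<in> inv_q_polys q (2 * t) \<and> \<rho> \<in> field_auts \<and>
    code_conj (poly L1 \<circ> \<rho>) (iv \<rho> \<circ> poly L2) (code_maps h) = code_maps h"
  using code_image_code_iff[OF h h] by (auto simp: aut_triples_def)

text \<open>For given \<open>\<rho>\<close> the pair determines \<open>L1\<close> and
  \<open>L2\<close>. So the group laws follow from those of composition, through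
  \<open>pair_mult\<close>.\<close>

lemma A_eqI:
  assumes "x \<in> carrier A" "y \<in> carrier A" "pair x = pair y" "snd (snd x) = snd (snd y)"
  shows "x = y"
proof -
  obtain L1 L2 \<rho> M1 M2 where x: "x = (L1, L2, \<rho>)" and y: "y = (M1, M2, \<rho>)"
    using assms(4) by (cases x, cases y) auto
  have \<rho>: "\<rho> \<in> field_auts" using assms(1) by (simp add: x carrier_A)
  have eq: "poly L1 \<circ> \<rho> = poly M1 \<circ> \<rho>" "iv \<rho> \<circ> poly L2 = iv \<rho> \<circ> poly M2"
    using assms(3) by (auto simp: x y pair_def)
  have "poly L1 x = poly M1 x" for x
    using fun_cong[OF eq(1), of "iv \<rho> x"] by (simp add: surj_f_inv_f field_auts_simps(11)[OF \<rho>])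
  moreover have "poly L2 x = poly M2 x" for x
    using fun_cong[OF eq(2), of x] field_auts_simps(11)[OF \<rho>] by (metis comp_apply surj_f_inv_f)
  ultimately show ?thesis
    using assms(1,2) by (auto simp: x y carrier_A inv_q_polys_iff intro!: poly_eqI_UNIV)
qed

lemma pair_mult:
  assumes "x \<in> carrier A" "y \<in> carrier A"
  shows "pair (x \<otimes>\<^bsub>A\<^esub> y) = (fst (pair x) \<circ> fst (pair y), snd (pair y) \<circ> snd (pair x))"
    "snd (snd (x \<otimes>\<^bsub>A\<^esub> y)) = snd (snd x) \<circ> snd (snd y)"
proof -
  obtain L1 L2 \<rho> M1 M2 \<sigma> where x: "x = (L1, L2, \<rho>)" and y: "y = (M1, M2, \<sigma>)"
    by (cases x, cases y) auto
  have a: "\<rho> \<in> field_auts" "\<sigma> \<in> field_auts"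
    using assms by (simp_all add: x y carrier_A)
  have "iv (\<rho> \<circ> \<sigma>) = iv \<sigma> \<circ> iv \<rho>"
    using a field_auts_simps(12) by (metis o_inv_distrib)
  then show "pair (x \<otimes>\<^bsub>A\<^esub> y) = (fst (pair x) \<circ> fst (pair y), snd (pair y) \<circ> snd (pair x))"
    using field_auts_simps(10)[OF a(1)]
    by (simp add: x y pair_def aut_triples_def fun_eq_iff poly_q_comp poly_map_poly_aut[OF a(1)])
  show "snd (snd (x \<otimes>\<^bsub>A\<^esub> y)) = snd (snd x) \<circ> snd (snd y)"
    by (simp add: x y aut_triples_def)
qed

lemma mult_A_closed:
  assumes "x \<in> carrier A" "y \<in> carrier A"
  shows "x \<otimes>\<^bsub>A\<^esub> y \<in> carrier A"
proof -
  obtain L1 L2 \<rho> M1 M2 \<sigma> where x: "x = (L1, L2, \<rho>)" and y: "y = (M1, M2, \<sigma>)"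
    by (cases x, cases y) auto
  note L = assms(1)[unfolded x carrier_A] and M = assms(2)[unfolded y carrier_A]
  have xy: "x \<otimes>\<^bsub>A\<^esub> y = (q_comp q (2*t) L1 (map_poly \<rho> M1), q_comp q (2*t) (map_poly \<rho> M2) L2, \<rho> \<circ> \<sigma>)"
    by (simp add: x y aut_triples_def)
  have p: "poly (q_comp q (2*t) L1 (map_poly \<rho> M1)) = poly L1 \<circ> (\<rho> \<circ> poly M1 \<circ> iv \<rho>)"
    "poly (q_comp q (2*t) (map_poly \<rho> M2) L2) = (\<rho> \<circ> poly M2 \<circ> iv \<rho>) \<circ> poly L2"
    using L by (auto simp: fun_eq_iff poly_q_comp poly_map_poly_aut)
  have "q_comp q (2*t) L1 (map_poly \<rho> M1) \<in> inv_q_polys q (2*t)"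
    "q_comp q (2*t) (map_poly \<rho> M2) L2 \<in> inv_q_polys q (2*t)"
    using L M by (auto simp: inv_q_polys_iff degree_q_comp p intro!: lin_units_comp[OF _ lin_units_conj] lin_units_comp[OF lin_units_conj])
  moreover have "code_conj (fst (pair (x \<otimes>\<^bsub>A\<^esub> y))) (snd (pair (x \<otimes>\<^bsub>A\<^esub> y))) (code_maps h) = code_maps h"
    unfolding pair_mult[OF assms] using L M by (simp add: x y pair_def flip: code_conj_code_conj)
  ultimately show ?thesis
    unfolding xy carrier_A using L M by (simp add: comp_in_field_auts pair_def)
qed

lemma one_A: "\<one>\<^bsub>A\<^esub> \<in> carrier A" "pair \<one>\<^bsub>A\<^esub> = (id, id)" "snd (snd \<one>\<^bsub>A\<^esub>) = id"
proof -
  have one: "\<one>\<^bsub>A\<^esub> = (monom 1 1, monom 1 1, id)" by (simp add: aut_triples_def)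
  show "pair \<one>\<^bsub>A\<^esub> = (id, id)" "snd (snd \<one>\<^bsub>A\<^esub>) = id"
    by (simp_all add: one pair_def poly_monom_1(2))
  show "\<one>\<^bsub>A\<^esub> \<in> carrier A"
    unfolding one carrier_A One_nat_def poly_monom_1(2)
    using monom_in_inv_q_polys[of 1] id_in_field_auts(1) by simp
qed

lemma group_A: "group A"
proof (rule groupI)
  show "\<one>\<^bsub>A\<^esub> \<in> carrier A" by (rule one_A)
next
  fix x y assume "x \<in> carrier A" "y \<in> carrier A"
  then show "x \<otimes>\<^bsub>A\<^esub> y \<in> carrier A" by (rule mult_A_closed)
next
  fix x y z assume "x \<in> carrier A" "y \<in> carrier A" "z \<in> carrier A"
  then show "x \<otimes>\<^bsub>A\<^esub> y \<otimes>\<^bsub>A\<^esub> z = x \<otimes>\<^bsub>A\<^esub> (y \<otimes>\<^bsub>A\<^esub> z)"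
    by (intro A_eqI) (simp_all add: mult_A_closed pair_mult comp_assoc)
next
  fix x assume "x \<in> carrier A"
  then show "\<one>\<^bsub>A\<^esub> \<otimes>\<^bsub>A\<^esub> x = x"
    by (intro A_eqI) (simp_all add: mult_A_closed pair_mult one_A)
next
  fix x assume xA: "x \<in> carrier A"
  obtain L1 L2 \<rho> where x: "x = (L1, L2, \<rho>)" by (cases x) auto
  note L = xA[unfolded x carrier_A]
  have \<rho>: "\<rho> \<in> field_auts" using L by blast
  note \<rho>i = inv_in_field_auts[OF \<rho>]
  have bij: "bij \<rho>" using field_auts_simps(12)[OF \<rho>] .
  have ivv: "iv (iv \<rho>) = \<rho>" using bij by (simp add: inv_inv_eq)
  have lin_units: "poly L1 \<in> lin_units" "poly L2 \<in> lin_units"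
    using L by (simp_all add: inv_q_polys_iff)
  \<comment> \<open>Conjugating the inverse of \<open>L1\<close> by \<open>iv \<rho>\<close> makes
    \<open>poly M1 \<circ> iv \<rho>\<close> the inverse of \<open>poly L1 \<circ> \<rho>\<close>;
    \<open>M2\<close> is chosen likewise.\<close>
  obtain M1 where M1: "M1 \<in> inv_q_polys q (2*t)" "poly M1 = iv \<rho> \<circ> iv (poly L1) \<circ> \<rho>"
    using inv_q_polys_obtain[OF lin_units_conj[OF \<rho>i lin_units_D(3)[OF lin_units(1)]]] ivv by metis
  obtain M2 where M2: "M2 \<in> inv_q_polys q (2*t)" "poly M2 = iv \<rho> \<circ> iv (poly L2) \<circ> \<rho>"
    using inv_q_polys_obtain[OF lin_units_conj[OF \<rho>i lin_units_D(3)[OF lin_units(2)]]] ivv by metis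
  define y where "y = (M1, M2, iv \<rho>)"
  have b: "bij (poly L1)" "bij (poly L2)" using lin_units_D(2) lin_units by auto
  note inj = bij_is_inj[OF bij] bij_is_inj[OF b(1)] bij_is_inj[OF b(2)]
  note surj = bij_is_surj[OF bij] bij_is_surj[OF b(1)] bij_is_surj[OF b(2)]
  have pairs: "fst (pair y) \<circ> fst (pair x) = id" "snd (pair x) \<circ> snd (pair y) = id"
    by (simp_all add: x y_def pair_def M1 M2 ivv fun_eq_iff inj surj surj_f_inv_f)
  have "code_conj (poly L1 \<circ> \<rho>) (iv \<rho> \<circ> poly L2) (code_maps h) = code_maps h"
    using L by blast
  then have "code_conj (fst (pair y)) (snd (pair y)) (code_maps h) =
      code_conj (fst (pair y)) (snd (pair y)) (code_conj (fst (pair x)) (snd (pair x)) (code_maps h))"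
    by (simp add: x pair_def)
  also have "\<dots> = code_maps h" by (simp add: code_conj_code_conj pairs)
  finally have yA: "y \<in> carrier A"
    unfolding y_def carrier_A using M1(1) M2(1) \<rho>i by (simp add: pair_def)
  have "y \<otimes>\<^bsub>A\<^esub> x = \<one>\<^bsub>A\<^esub>"
    using pair_mult[OF yA xA] pairs inj
    by (intro A_eqI mult_A_closed[OF yA xA] one_A) (simp_all add: one_A x y_def fun_eq_iff)
  then show "\<exists>y \<in> carrier A. y \<otimes>\<^bsub>A\<^esub> x = \<one>\<^bsub>A\<^esub>"
    using yA by blast
qed

section \<open>The factors of the semidirect product and the action\<close>

abbreviation N :: "('a \<times> 'a) monoid" where
  "N \<equiv> (subfield_units q (2 * t) :: 'a monoid) \<times>\<times> (subfield_units q 2 :: 'a monoid)"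

abbreviation H :: "('a \<Rightarrow> 'a) monoid" where "H \<equiv> aut_stabilizer q t h"

lemma group_N: "group N"
  by (intro DirProd_group group_subfield_units)

lemma carrier_N: "(a, z) \<in> carrier N \<longleftrightarrow> a \<noteq> 0 \<and> Q (Q z) = z \<and> z \<noteq> 0"
  using power_card_UNIV_eq[of a] by (auto simp: subfield_units_def card Q_power(2))

lemma N_simps: "(a, z) \<otimes>\<^bsub>N\<^esub> (b, w) = (a * b, z * w)" "\<one>\<^bsub>N\<^esub> = (1, 1)"
  by (auto simp: subfield_units_def)

lemma carrier_H: "\<rho> \<in> carrier H \<longleftrightarrow> \<rho> \<in> field_auts \<and> twist (\<rho> h / h)"
proof -
  have "(\<rho> h / h) ^ (q\<^sup>2 + 1) = (\<rho> h / h) * Q (Q (\<rho> h / h))"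
    by (simp only: Q_power(2) power_add power_one_right mult.commute)
  moreover have "h = \<rho> h \<or> h = - \<rho> h \<longleftrightarrow> \<rho> h / h = 1 \<or> \<rho> h / h = -1"
  proof -
    have "\<rho> h / h = 1 \<longleftrightarrow> \<rho> h = h" "\<rho> h / h = -1 \<longleftrightarrow> \<rho> h = - h"
      using h0 by (simp_all add: nonzero_divide_eq_eq)
    then show ?thesis by (metis minus_minus)
  qed
  ultimately show ?thesis by (auto simp: aut_stabilizer_def twist_def)
qed

lemma H_simps: "\<rho> \<otimes>\<^bsub>H\<^esub> \<sigma> = \<rho> \<circ> \<sigma>" "\<one>\<^bsub>H\<^esub> = id"
  by (simp_all add: aut_stabilizer_def)

lemma group_H: "group H"
proof (rule groupI)
  fix \<rho> \<sigma> assume \<rho>\<sigma>: "\<rho> \<in> carrier H" "\<sigma> \<in> carrier H"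
  then have "\<rho> \<in> field_auts" by (simp add: carrier_H)
  note r = field_auts_simps[OF this]
  \<comment> \<open>\<open>\<rho> \<mapsto> \<rho> h / h\<close> is a cocycle, and twists are closed
    under products and automorphisms.\<close>
  have eq: "\<rho> (\<sigma> h) / h = \<rho> (\<sigma> h / h) * (\<rho> h / h)" using h0 by (simp add: r)
  have "twist (\<rho> (\<sigma> h) / h)"
    unfolding eq by (rule twist_mult[OF twist_aut[of \<rho>]]) (use \<rho>\<sigma> in \<open>simp_all add: carrier_H\<close>)
  then show "\<rho> \<otimes>\<^bsub>H\<^esub> \<sigma> \<in> carrier H"
    using \<rho>\<sigma> unfolding carrier_H H_simps by (simp add: comp_in_field_auts)
next
  show "\<one>\<^bsub>H\<^esub> \<in> carrier H"
    using h0 by (auto simp: carrier_H H_simps twist_def)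
next
  fix \<rho> assume \<rho>: "\<rho> \<in> carrier H"
  then have a: "\<rho> \<in> field_auts" by (simp add: carrier_H)
  note i = inv_in_field_auts[OF a]
  have "iv \<rho> (1 / (\<rho> h / h)) = iv \<rho> h / h"
    using field_auts_simps(10)[OF a] by (simp add: field_auts_simps[OF i])
  moreover have "twist (iv \<rho> (1 / (\<rho> h / h)))"
    using \<rho> by (intro twist_aut[OF i] twist_inverse) (simp add: carrier_H)
  ultimately have "iv \<rho> \<in> carrier H" using i by (simp add: carrier_H)
  moreover have "iv \<rho> \<circ> \<rho> = id" using field_auts_simps(10)[OF a] by simp
  ultimately show "\<exists>y \<in> carrier H. y \<otimes>\<^bsub>H\<^esub> \<rho> = \<one>\<^bsub>H\<^esub>"
    by (auto simp: H_simps)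
qed (auto simp: H_simps comp_assoc)

text \<open>For odd \<open>t\<close>, an automorphism with \<open>\<rho> h = - h\<close> changes the sign of \<open>idealizer_coeff h\<close>,
  which amounts to replacing \<open>z\<close>
    by \<open>Q z\<close> in \<open>idealizer_map h z\<close>.\<close>

definition act :: "('a \<Rightarrow> 'a) \<Rightarrow> 'a \<Rightarrow> 'a" where
  "act \<rho> w = (if odd t \<and> \<rho> h \<noteq> h then Q (\<rho> w) else \<rho> w)"

text \<open>The restriction makes \<open>\<theta> \<rho>\<close> extensional, as membership in
  \<open>auto N\<close> demands.\<close>

definition \<theta> :: "('a \<Rightarrow> 'a) \<Rightarrow> 'a \<times> 'a \<Rightarrow> 'a \<times> 'a" where
  "\<theta> \<rho> = (\<lambda>x \<in> carrier N. (\<rho> (fst x), act \<rho> (snd x)))"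

lemma act_simps:
  assumes "\<rho> \<in> field_auts"
  shows "act \<rho> (z * w) = act \<rho> z * act \<rho> w" "act \<rho> z = 0 \<longleftrightarrow> z = 0"
    "act \<rho> z = act \<rho> w \<longleftrightarrow> z = w" "Q (Q z) = z \<Longrightarrow> Q (Q (act \<rho> z)) = act \<rho> z"
  using field_auts_simps(1-9)[OF assms] field_auts_simps(10)[OF assms] field_aut_QPJ[OF assms, symmetric]
  by (auto simp: act_def eq_via_QPJ inj_eq)

lemma H_odd:
  assumes "\<rho> \<in> carrier H" "odd t"
  shows "\<rho> h = h \<or> \<rho> h = - h"
proof -
  have "t mod 4 \<noteq> 2" using assms(2) by presburger
  then show ?thesis using assms(1) h0 by (auto simp: carrier_H twist_def field_simps)
qed

text \<open>For odd \<open>t\<close> the signs of \<open>\<rho> h / h\<close> and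
  \<open>\<sigma> h / h\<close> multiply; if both are \<open>-1\<close>, the two applications of
  \<open>Q\<close> cancel because \<open>z\<close> lies in the field of order
  \<open>q ^ 2\<close>.\<close>

lemma act_comp:
  assumes "\<rho> \<in> carrier H" "\<sigma> \<in> carrier H" "Q (Q z) = z"
  shows "act (\<rho> \<circ> \<sigma>) z = act \<rho> (act \<sigma> z)"
proof (cases "odd t")
  case True
  have a: "\<rho> \<in> field_auts" "\<sigma> \<in> field_auts" using assms by (simp_all add: carrier_H)
  have ne: "- h \<noteq> h" using h0 eq_minus_self_iff(2) by metis
  have "Q (Q (\<rho> (\<sigma> z))) = \<rho> (\<sigma> z)"
    using assms(3) by (simp add: field_aut_QPJ[OF a(1), symmetric] field_aut_QPJ[OF a(2), symmetric])
  then show ?thesis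
    using H_odd[OF assms(1) True] H_odd[OF assms(2) True] ne
    by (auto simp: act_def field_aut_QPJ[OF a(1)] field_auts_simps(5)[OF a(1)])
qed (simp add: act_def)

lemma theta_in: "\<rho> \<in> field_auts \<Longrightarrow> \<theta> \<rho> \<in> auto N"
proof -
  assume \<rho>: "\<rho> \<in> field_auts"
  note r = field_auts_simps[OF \<rho>] act_simps[OF \<rho>]
  have cl: "\<theta> \<rho> x \<in> carrier N" if "x \<in> carrier N" for x
  proof -
    have "(\<rho> (fst x), act \<rho> (snd x)) \<in> carrier N"
      using that unfolding carrier_N by (cases x) (simp only: carrier_N, simp add: r)
    then show ?thesis using that by (simp add: \<theta>_def)
  qed
  have "inj_on (\<theta> \<rho>) (carrier N)"
    by (rule inj_onI) (auto simp: \<theta>_def r inj_eq simp del: DirProd_def)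
  moreover have "\<theta> \<rho> ` carrier N \<subseteq> carrier N" using cl by blast
  ultimately have bij: "bij_betw (\<theta> \<rho>) (carrier N) (carrier N)"
    by (simp add: bij_betw_def endo_inj_surj)
  have "\<theta> \<rho> (x \<otimes>\<^bsub>N\<^esub> y) = \<theta> \<rho> x \<otimes>\<^bsub>N\<^esub> \<theta> \<rho> y" if xy: "x \<in> carrier N" "y \<in> carrier N" for x y
  proof -
    have "x \<otimes>\<^bsub>N\<^esub> y \<in> carrier N"
      using xy group_N by (metis group.is_monoid monoid.m_closed)
    then show ?thesis
      using xy by (cases x, cases y) (simp only: \<theta>_def restrict_apply if_True N_simps fst_conv snd_conv r)
  qed
  then have "\<theta> \<rho> \<in> hom N N" using cl by (auto simp: hom_def)
  moreover have "\<theta> \<rho> \<in> extensional (carrier N)"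
    unfolding \<theta>_def by (rule restrict_extensional)
  ultimately show ?thesis using bij unfolding auto_def Bij_def by blast
qed

lemma theta_hom: "\<theta> \<in> hom H (AutoGroup N)"
proof (rule homI)
  fix \<rho> assume "\<rho> \<in> carrier H"
  then show "\<theta> \<rho> \<in> carrier (AutoGroup N)"
    using theta_in by (simp add: AutoGroup_def carrier_H)
next
  fix \<rho> \<sigma> assume \<rho>\<sigma>: "\<rho> \<in> carrier H" "\<sigma> \<in> carrier H"
  have a: "\<theta> \<rho> \<in> auto N" "\<theta> \<sigma> \<in> auto N"
    using \<rho>\<sigma> theta_in by (auto simp: carrier_H)
  have "\<theta> (\<rho> \<circ> \<sigma>) x = compose (carrier N) (\<theta> \<rho>) (\<theta> \<sigma>) x" for x
  proof (cases "x \<in> carrier N")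
    case True
    have "\<theta> \<sigma> x \<in> carrier N" using a(2) True by (auto simp: auto_def hom_def)
    moreover have "Q (Q (snd x)) = snd x" using True by (cases x) (simp only: carrier_N snd_conv)
    ultimately show ?thesis using True act_comp[OF \<rho>\<sigma>, of "snd x"]
      by (simp only: \<theta>_def compose_def restrict_apply if_True) simp
  qed (simp add: \<theta>_def compose_def)
  then show "\<theta> (\<rho> \<otimes>\<^bsub>H\<^esub> \<sigma>) = \<theta> \<rho> \<otimes>\<^bsub>AutoGroup N\<^esub> \<theta> \<sigma>"
    using a by (simp add: H_simps AutoGroup_def BijGroup_def auto_def fun_eq_iff)
qed

section \<open>Parametrization of the pairs by the semidirect product\<close>

abbreviation SD where "SD \<equiv> semidirect N H \<theta>"

text \<open>The factors \<open>a * \<tau> x\<close> and \<open>iv \<tau>\<close> carry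
  \<open>code_maps h\<close> to \<open>code_maps (\<tau> h)\<close>, scaling by
  \<open>\<tau> f / f\<close> brings it back, and \<open>idealizer_map h z\<close> preserves
  it.\<close>

definition \<Psi> :: "('a \<times> 'a) \<times> ('a \<Rightarrow> 'a) \<Rightarrow> ('a \<Rightarrow> 'a) \<times> ('a \<Rightarrow> 'a)" where
  "\<Psi> = (\<lambda>((a, z), \<tau>). (\<lambda>x. a * \<tau> x, iv \<tau> \<circ> (\<lambda>x. \<tau> f / f * idealizer_map h z x)))"

lemma carrier_SD: "((a, z), \<tau>) \<in> carrier SD \<longleftrightarrow> a \<noteq> 0 \<and> Q (Q z) = z \<and> z \<noteq> 0 \<and> \<tau> \<in> carrier H"
  by (simp only: semidirect_def partial_object.simps mem_Times_iff fst_conv snd_conv carrier_N conj_assoc)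

lemma group_SD: "group SD"
  by (intro group_semidirect group_N group_H theta_hom)

lemma code_conj_cocycle:
  assumes "\<tau> \<in> carrier H"
  shows "\<tau> f / f \<noteq> 0" "code_conj id (\<lambda>x. \<tau> f / f * x) (code_maps (\<tau> h)) = code_maps h"
proof -
  have \<tau>: "\<tau> \<in> field_auts" and tw: "twist (\<tau> h / h)"
    using assms by (auto simp: carrier_H)
  note r = field_auts_simps[OF \<tau>]
  show nz: "\<tau> f / f \<noteq> 0" using f0 r by simp
  show "code_conj id (\<lambda>x. \<tau> f / f * x) (code_maps (\<tau> h)) = code_maps h"
  proof (rule code_conj_twist_I[OF tw h nz])
    \<comment> \<open>Since \<open>h = f * Q f\<close>, the quotient is \<open>S * Q S\<close> for
      \<open>S = \<tau> f / f\<close>, and both sides of the condition on the scale become the same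
      product.\<close>
    have "\<tau> h / h = \<tau> f / f * Q (\<tau> f / f)" if "t mod 4 = 2"
      unfolding f(1)[OF that, symmetric] by (simp add: r field_aut_QPJ[OF \<tau>])
    then show "if t mod 4 = 2 then Q (Q (\<tau> f / f)) * (\<tau> h / h) = Q (\<tau> h / h) * (\<tau> f / f) else \<tau> f / f = 1"
      using f(2) r by (auto simp only: if_split simp_thms) (simp_all add: mult_ac)
  qed
qed

lemma Psi_lift:
  assumes "s \<in> carrier SD"
  shows "\<exists>g \<in> carrier A. pair g = \<Psi> s"
proof -
  obtain a z \<tau> where s: "s = ((a, z), \<tau>)" by (metis surj_pair)
  have az: "a \<noteq> 0" "Q (Q z) = z" "z \<noteq> 0" and \<tau>H: "\<tau> \<in> carrier H"
    using assms unfolding s carrier_SD by blast+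
  have \<tau>: "\<tau> \<in> field_auts" using \<tau>H by (simp add: carrier_H)
  have "(\<lambda>x. \<tau> f / f * x) \<circ> idealizer_map h z \<in> lin_units"
    by (intro lin_units_comp lin_units_scale code_conj_cocycle[OF \<tau>H] lin_units_idealizer_map[OF h az(2,3)])
  then obtain L2 where L2: "L2 \<in> inv_q_polys q (2 * t)" "poly L2 = (\<lambda>x. \<tau> f / f * x) \<circ> idealizer_map h z"
    by (rule inv_q_polys_obtain)
  have pair: "pair (monom a 1, L2, \<tau>) = \<Psi> s"
    by (simp add: pair_def \<Psi>_def s L2 poly_monom fun_eq_iff)
  have "code_conj (fst (\<Psi> s)) (snd (\<Psi> s)) (code_maps h) = code_conj id (\<lambda>x. \<tau> f / f * idealizer_map h z x) (code_maps (\<tau> h))"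
    using code_conj_aut_code_maps_right[OF az(1) \<tau>] by (simp add: \<Psi>_def s)
  also have "\<dots> = code_conj id (idealizer_map h z) (code_conj id (\<lambda>x. \<tau> f / f * x) (code_maps (\<tau> h)))"
    by (simp add: code_conj_code_conj) (simp add: comp_def)
  also have "\<dots> = code_maps h"
    by (simp only: code_conj_cocycle[OF \<tau>H] code_conj_idealizer_map[OF h az(2,3)])
  finally have "(monom a 1, L2, \<tau>) \<in> carrier A"
    unfolding carrier_A using L2(1) \<tau> monom_in_inv_q_polys[OF az(1)]
    by (simp add: pair[symmetric] pair_def)
  then show ?thesis using pair by blast
qed

text \<open>\<open>code_conj_structure\<close> splits off \<open>a\<close> and
  \<open>\<tau>\<close>; here \<open>\<tau>\<close> may differ from \<open>\<rho>\<close>, since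
  \<open>L1\<close> can contain a Frobenius power. Dividing by the cocycle value leaves a map
  preserving \<open>code_maps h\<close> from the right, that is, an element of the right
  idealizer.\<close>

lemma Psi_surj:
  assumes "g \<in> carrier A"
  shows "\<exists>s \<in> carrier SD. \<Psi> s = pair g"
proof -
  obtain L1 L2 \<rho> where g: "g = (L1, L2, \<rho>)" by (cases g) auto
  note L = assms[unfolded g carrier_A]
  have \<rho>: "\<rho> \<in> field_auts" and lin_units: "poly L1 \<in> lin_units"
    and img: "code_conj (poly L1 \<circ> \<rho>) (iv \<rho> \<circ> poly L2) (code_maps h) = code_maps h"
    using L by (simp_all add: inv_q_polys_iff)
  define v where "v = iv \<rho> \<circ> poly L2"
  obtain a \<tau> where a: "a \<noteq> 0" and \<tau>: "\<tau> \<in> field_auts" and u: "poly L1 \<circ> \<rho> = (\<lambda>x. a * \<tau> x)"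
    and w: "code_conj id (\<tau> \<circ> v) (code_maps (\<tau> h)) = code_maps h"
    using code_conj_structure[OF h h semilinear_bij_additive[OF lin_units \<rho>] img] unfolding v_def by metis
  have "twist (\<tau> h / h)" using code_conj_twist_D[OF norm_m1_aut[OF \<tau> h] h w] .
  then have \<tau>H: "\<tau> \<in> carrier H" using \<tau> by (simp add: carrier_H)
  define S where "S = \<tau> f / f"
  have S: "S \<noteq> 0" "code_conj id (\<lambda>x. S * x) (code_maps (\<tau> h)) = code_maps h"
    using code_conj_cocycle[OF \<tau>H] by (auto simp: S_def)
  define w' where "w' = (\<lambda>x. \<tau> (v x) / S)"
  have Sw: "(\<lambda>x. S * x) \<circ> w' = \<tau> \<circ> v"
    using S(1) by (simp add: w'_def fun_eq_iff)
  have "code_conj id w' (code_maps h) = code_conj id w' (code_conj id (\<lambda>x. S * x) (code_maps (\<tau> h)))"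
    by (simp only: S)
  also have "\<dots> = code_maps h" by (simp add: code_conj_code_conj Sw w)
  finally have w': "code_conj id w' (code_maps h) = code_maps h" .
  obtain x0 where "w' x0 \<noteq> 0" using code_conj_right_D(3)[OF w'] by blast
  then obtain z where z: "Q (Q z) = z" "z \<noteq> 0" "w' = idealizer_map h z"
    using code_maps_right_idealizer[OF h code_conj_right_D(1,2)[OF w']] by blast
  have "\<tau> (v x) = S * idealizer_map h z x" for x using fun_cong[OF Sw, of x] by (simp add: z)
  then have "v x = iv \<tau> (S * idealizer_map h z x)" for x
    using field_auts_simps(10)[OF \<tau>] by (metis inv_f_f)
  then have "\<Psi> ((a, z), \<tau>) = pair g"
    by (simp add: \<Psi>_def g pair_def u v_def[symmetric] S_def fun_eq_iff)
  moreover have "((a, z), \<tau>) \<in> carrier SD" unfolding carrier_SD using a z \<tau>H by blast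
  ultimately show ?thesis by blast
qed

text \<open>The value of the left map at \<open>1\<close> is \<open>a\<close>, which then gives
  \<open>\<tau>\<close>; cancelling the cocycle value leaves \<open>idealizer_map h z\<close>, which
  determines \<open>z\<close>.\<close>

lemma Psi_inj:
  assumes "s \<in> carrier SD" "s' \<in> carrier SD" "\<Psi> s = \<Psi> s'"
  shows "s = s'"
proof -
  obtain a z \<tau> a' z' \<tau>' where s: "s = ((a, z), \<tau>)" "s' = ((a', z'), \<tau>')"
    by (metis surj_pair)
  have c: "a \<noteq> 0" "Q (Q z) = z" "\<tau> \<in> carrier H" "a' \<noteq> 0" "Q (Q z') = z'" "\<tau>' \<in> carrier H"
    using assms(1,2) unfolding s carrier_SD by blast+
  have \<tau>: "\<tau> \<in> field_auts" "\<tau>' \<in> field_auts" using c by (auto simp: carrier_H)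
  have u: "a * \<tau> x = a' * \<tau>' x" and v: "iv \<tau> (\<tau> f / f * idealizer_map h z x) = iv \<tau>' (\<tau>' f / f * idealizer_map h z' x)" for x
    using assms(3) by (simp_all add: s \<Psi>_def fun_eq_iff)
  have aa: "a = a'" using u[of 1]
    by (simp add: field_auts_simps[OF \<tau>(1)] field_auts_simps[OF \<tau>(2)])
  then have \<tau>\<tau>: "\<tau> = \<tau>'" using u c by (auto simp: fun_eq_iff)
  have "inj (iv \<tau>)" using field_auts_simps(10)[OF inv_in_field_auts[OF \<tau>(1)]] .
  then have "\<tau> f / f * idealizer_map h z x = \<tau> f / f * idealizer_map h z' x" for x
    using v[of x] by (simp add: \<tau>\<tau> inj_eq)
  then have "idealizer_map h z x = idealizer_map h z' x" for x
    using code_conj_cocycle(1)[OF c(3)] by (metis mult_left_cancel)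
  then have "z = z'" using inj_on_idealizer_map[OF h c(2,5)] by blast
  then show ?thesis by (simp add: s aa \<tau>\<tau>)
qed

text \<open>The commutation rule that dictates \<open>act\<close>: moving \<open>\<tau>\<close>
  across an idealizer map changes its parameter to \<open>\<tau> h\<close>. For even
  \<open>t\<close> the map is a scalar; for odd \<open>t\<close>, \<open>\<tau> h\<close> is
  \<open>h\<close> or \<open>- h\<close>, and \<open>idealizer_map_minus\<close> applies.\<close>

lemma idealizer_map_act:
  assumes \<tau>: "\<tau> \<in> carrier H" and y: "Q (Q y) = y"
  shows "\<tau> (idealizer_map h y (iv \<tau> (\<tau> f / f * x))) = \<tau> f / f * idealizer_map h (act \<tau> y) x"
proof -
  have a: "\<tau> \<in> field_auts" using \<tau> by (simp add: carrier_H)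
  have "\<tau> (iv \<tau> X) = X" for X using field_auts_simps(11)[OF a] by (simp add: surj_f_inv_f)
  then have *: "\<tau> (idealizer_map h y (iv \<tau> X)) = idealizer_map (\<tau> h) (\<tau> y) X" for X
    by (simp add: idealizer_map_aut[OF a])
  show ?thesis
  proof (cases "even t")
    case True
    then show ?thesis unfolding * by (simp add: idealizer_map_def act_def)
  next
    case False
    then have "t mod 4 \<noteq> 2" by presburger
    then have "f = 1" using f(2) by blast
    moreover have "Q (Q (\<tau> y)) = \<tau> y" using y by (simp add: field_aut_QPJ[OF a, symmetric])
    ultimately show ?thesis unfolding *
      using H_odd[OF \<tau> False] False h0 by (auto simp: act_def idealizer_map_minus field_auts_simps[OF a])
  qed
qed

text \<open>The cocycle identity for \<open>\<tau> f / f\<close> together with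
  \<open>idealizer_map_act\<close> turns composition of pairs into the product twisted by
  \<open>\<theta>\<close>. The right maps compose in reverse order, which is harmless as idealizer
  maps commute.\<close>

lemma Psi_mult:
  assumes "s \<in> carrier SD" "s' \<in> carrier SD"
  shows "\<Psi> (s \<otimes>\<^bsub>SD\<^esub> s') = (fst (\<Psi> s) \<circ> fst (\<Psi> s'), snd (\<Psi> s') \<circ> snd (\<Psi> s))"
proof -
  obtain a z \<tau> b y \<sigma> where s: "s = ((a, z), \<tau>)" "s' = ((b, y), \<sigma>)"
    by (metis surj_pair)
  have c: "a \<noteq> 0" "Q (Q z) = z" "\<tau> \<in> carrier H" "b \<noteq> 0" "Q (Q y) = y" "y \<noteq> 0" "\<sigma> \<in> carrier H"
    using assms(1,2) unfolding s carrier_SD by blast+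
  have \<tau>: "\<tau> \<in> field_auts" and \<sigma>: "\<sigma> \<in> field_auts"
    using c by (auto simp: carrier_H)
  have iv: "iv (\<tau> \<circ> \<sigma>) = iv \<sigma> \<circ> iv \<tau>"
    using \<tau> \<sigma> field_auts_simps(12) by (metis o_inv_distrib)
  have "(b, y) \<in> carrier N" unfolding carrier_N using c by blast
  then have "\<theta> \<tau> (b, y) = (\<tau> b, act \<tau> y)"
    by (simp only: \<theta>_def restrict_apply if_True fst_conv snd_conv)
  then have prod: "s \<otimes>\<^bsub>SD\<^esub> s' = ((a * \<tau> b, z * act \<tau> y), \<tau> \<circ> \<sigma>)"
    by (simp only: semidirect_def monoid.simps case_prod_conv s N_simps H_simps)
  have act: "Q (Q (act \<tau> y)) = act \<tau> y" by (rule act_simps(4)[OF \<tau> c(5)])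
  have "iv \<sigma> (\<sigma> f / f * idealizer_map h y (iv \<tau> (\<tau> f / f * idealizer_map h z x)))
      = iv \<sigma> (iv \<tau> (\<tau> (\<sigma> f) / f * idealizer_map h (z * act \<tau> y) x))" for x
  proof -
    have "\<tau> (\<sigma> f / f * idealizer_map h y (iv \<tau> (\<tau> f / f * idealizer_map h z x)))
        = \<tau> (\<sigma> f) / \<tau> f * (\<tau> f / f * idealizer_map h (act \<tau> y) (idealizer_map h z x))"
      by (simp only: field_auts_simps(2,7)[OF \<tau>] idealizer_map_act[OF c(3,5)])
    also have "\<dots> = \<tau> (\<sigma> f) / f * idealizer_map h (z * act \<tau> y) x"
      using f0 field_auts_simps(9)[OF \<tau>] by (simp add: idealizer_map_mult[OF h act c(2)] mult.commute)
    finally show ?thesis using field_auts_simps(10)[OF \<tau>] by (metis inv_f_f)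
  qed
  then show ?thesis
    unfolding prod by (simp add: s \<Psi>_def iv fun_eq_iff field_auts_simps[OF \<tau>] mult.assoc)
qed

lemma Psi_one: "\<Psi> \<one>\<^bsub>SD\<^esub> = (id, id)"
proof -
  have "\<one>\<^bsub>SD\<^esub> = ((1, 1), id)"
    by (simp only: semidirect_def monoid.simps N_simps H_simps)
  then show ?thesis using f0 by (simp add: \<Psi>_def fun_eq_iff idealizer_map_1)
qed

section \<open>Passage to the quotient by the trivial triples\<close>

text \<open>This is \<open>pair\<close> followed by the inverse of \<open>\<Psi>\<close>; on
  \<open>carrier A\<close> the description is satisfiable by \<open>Psi_surj\<close> and unique by
  \<open>Psi_inj\<close>.\<close>

definition \<Phi> :: "'a poly \<times> 'a poly \<times> ('a \<Rightarrow> 'a) \<Rightarrow> ('a \<times> 'a) \<times> ('a \<Rightarrow> 'a)" where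
  "\<Phi> g = (THE s. s \<in> carrier SD \<and> \<Psi> s = pair g)"

lemma Phi_eqI: "s \<in> carrier SD \<Longrightarrow> \<Psi> s = pair g \<Longrightarrow> \<Phi> g = s"
  unfolding \<Phi>_def by (rule the_equality) (auto intro: Psi_inj)

lemma Phi: "g \<in> carrier A \<Longrightarrow> \<Phi> g \<in> carrier SD" "g \<in> carrier A \<Longrightarrow> \<Psi> (\<Phi> g) = pair g"
  using Psi_surj Phi_eqI by metis+

lemma group_hom_Phi: "group_hom A SD \<Phi>"
proof (intro group_hom.intro group_hom_axioms.intro group_A group_SD homI)
  fix x assume "x \<in> carrier A"
  then show "\<Phi> x \<in> carrier SD" by (rule Phi)
next
  fix x y assume xy: "x \<in> carrier A" "y \<in> carrier A"
  show "\<Phi> (x \<otimes>\<^bsub>A\<^esub> y) = \<Phi> x \<otimes>\<^bsub>SD\<^esub> \<Phi> y"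
  proof (rule Phi_eqI)
    show "\<Phi> x \<otimes>\<^bsub>SD\<^esub> \<Phi> y \<in> carrier SD"
      using group_SD Phi(1) xy by (metis group.is_monoid monoid.m_closed)
    show "\<Psi> (\<Phi> x \<otimes>\<^bsub>SD\<^esub> \<Phi> y) = pair (x \<otimes>\<^bsub>A\<^esub> y)"
      using xy by (simp add: Psi_mult Phi pair_mult)
  qed
qed

text \<open>The kernel consists of the triples in \<open>carrier A\<close> with pair
  \<open>(id, id)\<close>; conversely a trivial triple acts as the identity on every code and so
  lies in \<open>carrier A\<close>.\<close>

lemma kernel_Phi: "kernel A SD \<Phi> = trivial_triples q (2 * t)"
proof -
  have one: "\<one>\<^bsub>SD\<^esub> \<in> carrier SD"
    using group_SD by (metis group.is_monoid monoid.one_closed)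
  have "x \<in> kernel A SD \<Phi> \<longleftrightarrow> x \<in> carrier A \<and> pair x = (id, id)" for x
    using Phi[of x] Phi_eqI[OF one, of x] Psi_one by (auto simp: kernel_def)
  moreover have "x \<in> carrier A \<and> pair x = (id, id) \<longleftrightarrow> x \<in> trivial_triples q (2 * t)" for x
  proof -
    obtain L1 L2 \<rho> where x: "x = (L1, L2, \<rho>)" by (cases x) auto
    show ?thesis by (auto simp: x carrier_A pair_def trivial_triples_def)
  qed
  ultimately show ?thesis by blast
qed

text \<open>The first isomorphism theorem for \<open>\<Phi>\<close>, which is onto by
  \<open>Psi_lift\<close>.\<close>

theorem aut_group_iso_semidirect: "aut_group q (2 * t) (code q t h) \<cong> SD"
proof -
  have "\<Phi> ` carrier A = carrier SD"
  proof
    show "\<Phi> ` carrier A \<subseteq> carrier SD" using Phi by blast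
    show "carrier SD \<subseteq> \<Phi> ` carrier A"
    proof
      fix s assume s: "s \<in> carrier SD"
      then obtain g where "g \<in> carrier A" "pair g = \<Psi> s" using Psi_lift by blast
      then show "s \<in> \<Phi> ` carrier A" using Phi_eqI[OF s, of g] by auto
    qed
  qed
  then show ?thesis
    unfolding aut_group_def kernel_Phi[symmetric] by (rule group_hom.FactGroup_iso[OF group_hom_Phi])
qed

end

theorem theorem4p2:
  fixes q t n :: nat and h k :: "'a :: {field, finite}"
  assumes "primepow q" and "odd q" and "t > 4" and "n = 2 * t"
    and "card (UNIV :: 'a set) = q ^ n"
    and "h ^ (q ^ t + 1) = -1" and "k ^ (q ^ t + 1) = -1"
  shows "(t mod 4 \<noteq> 2 \<longrightarrow>
            (equiv_codes q n (code q t h) (code q t k) \<longleftrightarrow>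
             (\<exists>\<rho> \<in> field_auts. h = \<rho> k \<or> h = - \<rho> k))) \<and>
         (t mod 4 = 2 \<longrightarrow>
            (equiv_codes q n (code q t h) (code q t k) \<longleftrightarrow>
             (\<exists>l. \<exists>\<rho> \<in> field_auts. l ^ (q\<^sup>2 + 1) = 1 \<and> h = l * \<rho> k))) \<and>
         (\<exists>\<theta> \<in> hom (aut_stabilizer q t h)
                  (AutoGroup ((subfield_units q n :: 'a monoid) \<times>\<times> (subfield_units q 2 :: 'a monoid))).
            aut_group q n (code q t h) \<cong>
            semidirect ((subfield_units q n :: 'a monoid) \<times>\<times> (subfield_units q 2 :: 'a monoid))
              (aut_stabilizer q t h) \<theta>)"
proof -
  have n: "n = 2 * t" by fact
  interpret even_degree_field q t "TYPE('a)"
    using assms by unfold_locales simp_all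
  have h: "norm_m1 h" and k: "norm_m1 k" using assms(6,7) by (simp_all only: norm_m1_power)
  have nz: "h \<noteq> 0" "k \<noteq> 0" using norm_m1D h k by auto
  have pow: "l ^ (q\<^sup>2 + 1) = l * Q (Q l)" for l
    by (simp only: Q_power(2) power_add power_one_right mult.commute)
  have equiv: "equiv_codes q n (code q t h) (code q t k) \<longleftrightarrow>
      (\<exists>\<rho> \<in> field_auts. \<exists>l. twist l \<and> h = l * \<rho> k)"
    unfolding n equiv_codes_iff_twist[OF h k]
  proof
    assume "\<exists>\<tau> \<in> field_auts. twist (\<tau> h / k)"
    then obtain \<tau> where \<tau>: "\<tau> \<in> field_auts" "twist (\<tau> h / k)" by blast
    note i = inv_in_field_auts[OF \<tau>(1)]
    \<comment> \<open>The inverse automorphism moves the action from \<open>h\<close> to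
      \<open>k\<close>.\<close>
    have "h = iv \<tau> (\<tau> h / k) * iv \<tau> k"
      using nz field_auts_simps(10)[OF \<tau>(1)] by (simp add: field_auts_simps[OF i])
    then show "\<exists>\<rho> \<in> field_auts. \<exists>l. twist l \<and> h = l * \<rho> k"
      using i twist_aut[OF i \<tau>(2)] by blast
  next
    assume "\<exists>\<rho> \<in> field_auts. \<exists>l. twist l \<and> h = l * \<rho> k"
    then obtain \<rho> l where \<rho>: "\<rho> \<in> field_auts" "twist l" "h = l * \<rho> k" by blast
    note i = inv_in_field_auts[OF \<rho>(1)]
    have "iv \<rho> h / k = iv \<rho> l"
      using nz field_auts_simps(10)[OF \<rho>(1)] by (simp add: \<rho>(3) field_auts_simps[OF i])
    then show "\<exists>\<tau> \<in> field_auts. twist (\<tau> h / k)"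
      using i twist_aut[OF i \<rho>(2)] by metis
  qed
  \<comment> \<open>The splitting element: a root of \<open>h = f ^ (q + 1)\<close> if
    \<open>t mod 4 = 2\<close>, where \<open>t\<close> is even, and \<open>1\<close>
    otherwise.\<close>
  obtain f where "f \<noteq> 0" "t mod 4 = 2 \<Longrightarrow> f * Q f = h" "t mod 4 \<noteq> 2 \<Longrightarrow> f = 1"
  proof (cases "t mod 4 = 2")
    case True
    then have "even t" by presburger
    then obtain f where f: "f * Q f = h" using exists_q1_root[OF h] by blast
    then have "f \<noteq> 0" using nz by auto
    then show ?thesis using that f True by blast
  qed (use that[of 1] in auto)
  then interpret tw: twisted_code q t "TYPE('a)" h f
    using h by unfold_locales
  show ?thesis
  proof (intro conjI impI)
    assume t: "t mod 4 \<noteq> 2"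
    show "equiv_codes q n (code q t h) (code q t k) \<longleftrightarrow> (\<exists>\<rho> \<in> field_auts. h = \<rho> k \<or> h = - \<rho> k)"
      unfolding equiv by (rule bex_cong[OF refl]) (use t in \<open>auto simp: twist_def\<close>)
  next
    assume t: "t mod 4 = 2"
    show "equiv_codes q n (code q t h) (code q t k) \<longleftrightarrow>
        (\<exists>l. \<exists>\<rho> \<in> field_auts. l ^ (q\<^sup>2 + 1) = 1 \<and> h = l * \<rho> k)"
      unfolding equiv pow using t by (auto simp: twist_def)
  qed (use tw.theta_hom tw.aut_group_iso_semidirect in \<open>unfold n, blast\<close>)
qed

end
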